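(* Let $\alpha\in(0,1)$ and assume that $$\big\|\Gamma^\ast_{S^c,S}(\Gamma^\ast_{S,S})^{-1}\big\|_{\infty,\mathrm{op}}\le 1-\alpha .$$ Put $\eta=\min\{d\,\|\Sigma^\ast\|_{\infty,\mathrm{op}}\,\|K^\ast\|_{\infty,\mathrm{op}}^2,\ \|\mathrm{vec}(K^\ast)\|_1\}$. Let $\hat K$ be the unique solution of $$\hat K=\arg\min_{K\in\mathrm{Sym}_+(p)}\Big\{\mathrm{tr}(\hat\Sigma K)-\log\det(K)+\lambda\sum_{i\ne j}|K_{ij}|\Big\}\quad\text{with}\quad \lambda=\frac{\min\left\{\frac\alpha4,\ \eta\,\|K^\ast\|_{\infty,\mathrm{op}}^{-2}\,\Theta_{\min}\right\}(1-\alpha/2)}{\eta},$$ and define $$\delta=\begin{cases}\dfrac{\alpha^2}{16\,\eta}\left(1-\dfrac\alpha3\right),&\text{if }\alpha\le 4\,\eta\,\|K^\ast\|_{\infty,\mathrm{op}}^{-2}\,\Theta_{\min},\\[2mm] \dfrac\alpha6\,\|K^\ast\|_{\infty,\mathrm{op}}^{-2}\,\Theta_{\min},&\text{otherwise}.\end{cases}$$ If $\|\mathrm{vec}(\hat\Sigma-\Sigma^\ast)\|_\infty\le\delta$, then $\mathrm{sign}(\hat K)=\mathrm{sign}(K^\ast)$ (entrywise) and $$\|\mathrm{vec}(\hat K-K^\ast)\|_\infty\le\frac{\alpha\,\|K^\ast\|_{\infty,\mathrm{op}}^2}{4\,\eta}=\frac\alpha4\max\left\{\frac1{d\,\|\Sigma^\ast\|_{\infty,\mathrm{op}}},\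 \frac{\|K^\ast\|_{\infty,\mathrm{op}}^2}{\|\mathrm{vec}(K^\ast)\|_1}\right\}.$$
   Context: $\mathrm{Sym}_+(p)$ is the set of real symmetric positive definite $p\times p$ matrices; $\mathrm{vec}(X)\in\mathbb R^{p^2}$ stacks the columns of $X$. $X$ is a zero-mean random vector in $\mathbb R^p$ with finite second moments and positive definite covariance matrix $\Sigma^\ast$; $K^\ast=(\Sigma^\ast)^{-1}$; $\hat\Sigma=\frac1n\sum_{i=1}^nX^{(i)}(X^{(i)})^\top$ for i.i.d. copies $X^{(i)}$ of $X$. The statement is pointwise, for any realization of $\hat\Sigma$ satisfying the stated inequality. $\|\cdot\|_{\infty,\mathrm{op}}$ is the $\ell_\infty$ operator norm of a matrix (maximum absolute row sum); $\|\cdot\|_1,\|\cdot\|_\infty$ are the vector $\ell_1$, $\ell_\infty$ norms. $\Gamma^\ast=\Sigma^\ast\otimes\Sigma^\ast$ is a $p^2\times p^2$ matrix whose rows and columns are indexed by ordered pairs $(i,j)\in\{1,\dots,p\}^2$ (compatibly with $\mathrm{vec}$). $S=\{(i,j):K^\ast_{ij}\ne0\}$ (it contains the diagonal pairs), $S^c$ is its complement, and $\Gamma^\ast_{S,S}$ (resp. $\Gamma^\ast_{S^c,S}$) is the submatrix of $\Gamma^\ast$ with rows in $S$ (resp. $S^c$) and columns in $S$. $d$ is the largest number of non-zero entries in any row of $K^\ast$, and $\Theta_{\min}=\min_{(i,j)\in S}|K^\ast_{ij}|$. The sign function satisfies $\mathrm{sign}(0)=0$. *)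

theory Defs
  imports "HOL-Analysis.Analysis" "HOL-Probability.Probability"
begin

definition sym_pos_def :: "(real ^ 'p ^ 'p) set" where
  "sym_pos_def = {A. transpose A = A \<and> (\<forall>x. x \<noteq> 0 \<longrightarrow> x \<bullet> (A *v x) > 0)}"

definition inf_op_norm :: "real ^ 'n ^ 'm \<Rightarrow> real" where
  "inf_op_norm A = Max (range (\<lambda>i. \<Sum>j\<in>UNIV. \<bar>A $ i $ j\<bar>))"

definition l1_norm :: "real ^ 'n \<Rightarrow> real" where
  "l1_norm x = (\<Sum>i\<in>UNIV. \<bar>x $ i\<bar>)"

text \<open>The coordinates of \<open>vectorize A\<close> are labelled by the matrix position \<open>(i, j)\<close> itself, where
  column stacking would use the number \<open>(j - 1) p + i\<close>. Under this labelling the entry of the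
  Kronecker product of \<open>A\<close> and \<open>B\<close> in row \<open>(i, j)\<close> and column \<open>(k, l)\<close> is \<open>A\<^sub>j\<^sub>l B\<^sub>i\<^sub>k\<close>, which gives
  the usual identity \<open>kronecker_vectorize\<close> below.\<close>

definition vectorize :: "real ^ 'n ^ 'm \<Rightarrow> real ^ ('m \<times> 'n)" where
  "vectorize A = (\<chi> ij. A $ fst ij $ snd ij)"

definition kronecker ::
  "real ^ 'n ^ 'm \<Rightarrow> real ^ 'r ^ 'q \<Rightarrow> real ^ ('r \<times> 'n) ^ ('q \<times> 'm)" where
  "kronecker A B = (\<chi> ij kl. A $ snd ij $ snd kl * B $ fst ij $ fst kl)"

lemma kronecker_vectorize:
  "kronecker A B *v vectorize X = vectorize (B ** X ** transpose A)"
  by (simp add: vec_eq_iff kronecker_def vectorize_def matrix_vector_mult_def matrix_matrix_mult_def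
      transpose_def UNIV_Times_UNIV[symmetric] sum.cartesian_product' sum_distrib_right
      del: UNIV_Times_UNIV)
    (auto intro!: sum.cong simp: mult_ac intro: sum.swap[THEN trans])

text \<open>The submatrix with rows in \<open>R\<close> and columns in \<open>C\<close> is represented by its extension by zero to
  the full index types. Products of submatrices with matching index sets and \<open>inf_op_norm\<close> are
  unaffected by this; if \<open>R\<close> is empty the norm is \<open>0\<close>. Accordingly, the inverse of the submatrix on
  \<open>S \<times> S\<close> is its two-sided inverse in the ring of matrices supported on \<open>S \<times> S\<close>, whose unit is
  \<open>submatrix S S (mat 1)\<close>.\<close>

definition submatrix :: "'m set \<Rightarrow> 'n set \<Rightarrow> real ^ 'n ^ 'm \<Rightarrow> real ^ 'n ^ 'm" where
  "submatrix R C A = (\<chi> i j. if i \<in> R \<and> j \<in> C then A $ i $ j else 0)"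

definition is_submatrix_inv :: "'n set \<Rightarrow> real ^ 'n ^ 'n \<Rightarrow> real ^ 'n ^ 'n \<Rightarrow> bool" where
  "is_submatrix_inv S A B \<longleftrightarrow> submatrix S S B = B \<and>
     submatrix S S A ** B = submatrix S S (mat 1) \<and>
     B ** submatrix S S A = submatrix S S (mat 1)"

definition submatrix_inv :: "'n set \<Rightarrow> real ^ 'n ^ 'n \<Rightarrow> real ^ 'n ^ 'n" where
  "submatrix_inv S A = (THE B. is_submatrix_inv S A B)"

lemma submatrix_unit_left: "submatrix S S (mat 1) ** submatrix S S B = submatrix S S B"
proof -
  have "(\<Sum>k\<in>UNIV. submatrix S S (mat 1) $ i $ k * submatrix S S B $ k $ j) =
      (\<Sum>k\<in>UNIV. if k = i then submatrix S S B $ i $ j else 0)" for i j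
    by (intro sum.cong) (auto simp: submatrix_def mat_def)
  then show ?thesis
    by (simp add: vec_eq_iff matrix_matrix_mult_def)
qed

lemma submatrix_unit_right: "submatrix S S B ** submatrix S S (mat 1) = submatrix S S B"
proof -
  have "(\<Sum>k\<in>UNIV. submatrix S S B $ i $ k * submatrix S S (mat 1) $ k $ j) =
      (\<Sum>k\<in>UNIV. if k = j then submatrix S S B $ i $ j else 0)" for i j
    by (intro sum.cong) (auto simp: submatrix_def mat_def)
  then show ?thesis
    by (simp add: vec_eq_iff matrix_matrix_mult_def)
qed

lemma submatrix_inv_eqI:
  assumes "is_submatrix_inv S A B"
  shows "submatrix_inv S A = B"
  unfolding submatrix_inv_def
proof (rule the_equality)
  show "is_submatrix_inv S A B" by (fact assms)
next
  fix C assume C: "is_submatrix_inv S A C"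
  have "C = C ** (submatrix S S A ** B)"
    using assms C submatrix_unit_right[of S C] by (simp add: is_submatrix_inv_def)
  also have "\<dots> = (C ** submatrix S S A) ** B"
    by (simp add: matrix_mul_assoc)
  also have "\<dots> = B"
    using assms C submatrix_unit_left[of S B] by (simp add: is_submatrix_inv_def)
  finally show "C = B" .
qed

definition support :: "real ^ 'p ^ 'p \<Rightarrow> ('p \<times> 'p) set" where
  "support K = {(i, j). K $ i $ j \<noteq> 0}"

definition max_row_card :: "real ^ 'p ^ 'p \<Rightarrow> nat" where
  "max_row_card K = Max (range (\<lambda>i. card {j. K $ i $ j \<noteq> 0}))"

definition theta_min :: "real ^ 'p ^ 'p \<Rightarrow> real" where
  "theta_min K = Min ((\<lambda>(i, j). \<bar>K $ i $ j\<bar>) ` support K)"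

definition covariance_matrix :: "'w measure \<Rightarrow> ('w \<Rightarrow> real ^ 'p) \<Rightarrow> real ^ 'p ^ 'p" where
  "covariance_matrix M X = (\<chi> i j.
     LINT w|M. (X w $ i - (LINT v|M. X v $ i)) * (X w $ j - (LINT v|M. X v $ j)))"

text \<open>No centring by the sample mean, as the population mean is zero.\<close>

definition sample_covariance :: "nat \<Rightarrow> (nat \<Rightarrow> real ^ 'p) \<Rightarrow> real ^ 'p ^ 'p" where
  "sample_covariance n x = (\<chi> j k. (\<Sum>i = 1..n. x i $ j * x i $ k) / real n)"

definition glasso_objective :: "real ^ 'p ^ 'p \<Rightarrow> real \<Rightarrow> real ^ 'p ^ 'p \<Rightarrow> real" where
  "glasso_objective A l K =
     trace (A ** K) - ln (det K) + l * (\<Sum>(i, j) | i \<noteq> j. \<bar>K $ i $ j\<bar>)"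

end

theory Submission
  imports Defs
begin

text \<open>Write \<open>\<kappa> = inf_op_norm K\<close>, let \<open>K' = K + Delta\<close> be a candidate minimizer, and put
  \<open>W = matrix_inv K'\<close>, \<open>E = W - Sigma\<close> and \<open>P = Sigma ** Delta ** Sigma\<close>. Since \<open>W ** K' = mat 1\<close>,
  \<open>E = - P - E ** (Delta ** Sigma)\<close>.
  So \<open>- P\<close> is the linearization of \<open>E\<close>, and the remainder \<open>R = E + P\<close> equals \<open>- E ** (Delta ** Sigma)\<close>.
  The optimality condition is \<open>W = Sigma_hat + lam *\<^sub>R Z\<close> with a subgradient \<open>Z\<close> of the off-diagonal
  \<open>l1\<close> norm at \<open>K'\<close>. If \<open>Delta\<close> vanishes off the support \<open>S\<close> and does not change signs, then on \<open>S\<close>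
  it says that \<open>P\<close> equals \<open>R - (Sigma_hat - Sigma) - lam *\<^sub>R Z0\<close>, where \<open>Z0\<close> is the off-diagonal part of
  the sign matrix of \<open>K\<close>. Conversely the entries of \<open>P\<close> on \<open>S\<close> determine \<open>Delta\<close>, and incoherence
  makes the entries of \<open>P\<close> off \<open>S\<close> smaller by the factor \<open>1 - \<alpha>\<close>.

  Everything is measured in the largest absolute entry, and the point where \<open>\<eta>\<close> enters is
  \<open>sandwich_entry_contraction\<close>: if all entries of \<open>P\<close> are at most \<open>b\<close>, then right multiplication by
  \<open>Delta ** Sigma\<close> shrinks the largest entry of any matrix by the factor \<open>\<eta> * b\<close>. Each of the two terms
  in the minimum defining \<open>\<eta>\<close> is one way to see this: \<open>Delta ** Sigma = K ** P\<close> gives the \<open>l1\<close> norm of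
  \<open>K\<close>, and counting the at most \<open>d\<close> non-zero entries in a column of \<open>Delta\<close>, each at most
  \<open>\<kappa>\<^sup>2 * b\<close>, gives the other term. When \<open>\<eta> * b < 1\<close>, the identity for \<open>E\<close> therefore bounds \<open>E\<close> by
  \<open>b / (1 - \<eta> * b)\<close> and \<open>R\<close> by \<open>\<rho> = \<eta> * b\<^sup>2 / (1 - \<eta> * b)\<close>.

  Take \<open>b = min (\<alpha> / 4) (\<eta> * \<theta> / \<kappa>\<^sup>2) / \<eta>\<close>, so that \<open>lam = (1 - \<alpha> / 2) * b\<close>. The value of \<open>\<delta>\<close> is
  such that \<open>\<delta> + \<rho> < \<alpha> / 2 * b\<close> (\<open>glasso_noise_room\<close>), and this one inequality does three things in
  \<open>glasso_witness\<close>. It gives \<open>\<rho> + \<delta> + lam < b\<close>, so the map sending \<open>P\<close> on \<open>S\<close> to the right-hand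
  side above preserves the box of symmetric matrices with entries at most \<open>b\<close>, and Brouwer's theorem
  yields a fixed point. Strictness there gives \<open>\<bar>Delta $ i $ j\<bar> < \<kappa>\<^sup>2 * b \<le> \<theta>\<close>, so the signs of \<open>K'\<close>
  are those of \<open>K\<close>. Off \<open>S\<close> it gives \<open>\<bar>W - Sigma_hat\<bar> \<le> \<rho> + (1 - \<alpha>) * b + \<delta> \<le> lam\<close> entrywise,
  so \<open>Z\<close> is a subgradient.

  Finally \<open>ln_det_tangent\<close>, the strict concavity of the log determinant, makes any point that satisfies
  the optimality condition the unique minimizer (\<open>glasso_kkt_sufficient\<close>). Existence, uniqueness, the
  signs and the error bound are thus all read off from the fixed point.\<close>

section \<open>The spectral theorem\<close>

lemma symmetric_nth:
  fixes A :: "'a ^ 'n ^ 'n"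
  assumes "transpose A = A"
  shows "A $ i $ j = A $ j $ i"
  using arg_cong[OF assms, of "\<lambda>M. M $ i $ j"] by (simp add: transpose_def)

lemma symmetric_dot_commute:
  fixes A :: "real ^ 'n ^ 'n"
  assumes "transpose A = A"
  shows "x \<bullet> (A *v y) = (A *v x) \<bullet> y"
  by (metis assms dot_lmul_matrix vector_transpose_matrix)

text \<open>Along the line \<open>x + t z\<close> the quadratic form is \<open>2 t (z \<bullet> M x) + t\<^sup>2 (z \<bullet> M z)\<close>, which takes negative
  values near \<open>t = 0\<close> unless its linear coefficient vanishes.\<close>

lemma semidefinite_null_vector:
  fixes M :: "real ^ 'n ^ 'n"
  assumes sym: "transpose M = M" and W: "subspace W"
    and psd: "\<And>x. x \<in> W \<Longrightarrow> 0 \<le> x \<bullet> (M *v x)"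
    and x: "x \<in> W" "x \<bullet> (M *v x) = 0" and z: "z \<in> W"
  shows "z \<bullet> (M *v x) = 0"
proof (rule ccontr)
  define a b where "a = z \<bullet> (M *v z)" and "b = z \<bullet> (M *v x)"
  assume "z \<bullet> (M *v x) \<noteq> 0"
  then have b: "b\<^sup>2 > 0" by (simp add: b_def)
  have a: "a \<ge> 0" using psd z by (simp add: a_def)
  have xz: "x \<bullet> (M *v z) = b"
    by (metis b_def inner_commute sym symmetric_dot_commute)
  \<comment> \<open>The vertex of the parabola is at \<open>- b / a\<close>; the shift by 1 covers \<open>a = 0\<close>.\<close>
  define t where "t = - b / (a + 1)"
  have "0 \<le> (x + t *\<^sub>R z) \<bullet> (M *v (x + t *\<^sub>R z))"
    using psd W x z by (simp add: subspace_add subspace_scale)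
  also have "\<dots> = 2 * t * b + t\<^sup>2 * a"
    using x(2) xz by (simp add: matrix_vector_right_distrib matrix_vector_mult_scaleR
        inner_add_left inner_add_right a_def[symmetric] b_def[symmetric] power2_eq_square algebra_simps)
  also have "\<dots> = - (b\<^sup>2 * (a + 2)) / (a + 1)\<^sup>2"
  proof -
    have "a + 1 \<noteq> 0" using a by simp
    then show ?thesis unfolding t_def by (simp add: divide_simps) algebra
  qed
  also have "\<dots> < 0"
    using a b by (intro divide_neg_pos) auto
  finally show False by simp
qed

text \<open>A maximizer of the Rayleigh quotient on the unit sphere of \<open>W\<close> is an eigenvector: with \<open>c\<close> the maximal
  value, the form of \<open>c *\<^sub>R mat 1 - A\<close> is non-negative on \<open>W\<close> and vanishes at the maximizer.\<close>

lemma eigenvector_in_invariant_subspace: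
  fixes A :: "real ^ 'n ^ 'n"
  assumes sym: "transpose A = A" and W: "subspace W" and inv: "\<And>x. x \<in> W \<Longrightarrow> A *v x \<in> W"
    and u: "u \<in> W" "u \<noteq> 0"
  obtains x c where "x \<in> W" "norm x = 1" "A *v x = c *\<^sub>R x"
proof -
  define T where "T = W \<inter> sphere 0 1"
  have "compact T"
    unfolding T_def using W by (intro closed_Int_compact closed_subspace) auto
  moreover have "u /\<^sub>R norm u \<in> T"
    using u W by (simp add: T_def subspace_scale)
  then have "T \<noteq> {}" by blast
  moreover have "continuous_on T (\<lambda>x. x \<bullet> (A *v x))"
    by (intro continuous_intros linear_continuous_on) (simp add: linear_conv_bounded_linear[symmetric])
  ultimately obtain x where x: "x \<in> T" and max: "\<And>y. y \<in> T \<Longrightarrow> y \<bullet> (A *v y) \<le> x \<bullet> (A *v x)"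
    using continuous_attains_sup by metis
  define c where "c = x \<bullet> (A *v x)"
  define M where "M = c *\<^sub>R mat 1 - A"
  have M: "M *v y = c *\<^sub>R y - A *v y" for y
    by (simp add: M_def matrix_vector_mult_diff_rdistrib flip: scaleR_matrix_vector_assoc)
  have xW: "x \<in> W" "norm x = 1" using x by (auto simp: T_def)
  have "0 \<le> y \<bullet> (M *v y)" if y: "y \<in> W" for y
  proof (cases "y = 0")
    case False
    then have "y /\<^sub>R norm y \<in> T" using y W by (simp add: T_def subspace_scale)
    from max[OF this] have "(y \<bullet> (A *v y)) / (norm y)\<^sup>2 \<le> c"
      by (simp add: c_def matrix_vector_mult_scaleR power2_eq_square divide_inverse mult_ac)
    then have "y \<bullet> (A *v y) \<le> c * (norm y)\<^sup>2"
      using False by (simp add: field_simps)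
    then show ?thesis by (simp add: M inner_diff_right dot_square_norm)
  qed simp
  moreover have "x \<bullet> (M *v x) = 0"
    using xW by (simp add: M inner_diff_right c_def dot_square_norm)
  moreover have "transpose M = M"
    using sym by (simp add: M_def vec_eq_iff transpose_def mat_def)
  moreover have "M *v x \<in> W"
    using xW W inv by (simp add: M subspace_diff subspace_scale)
  ultimately have "(M *v x) \<bullet> (M *v x) = 0"
    using semidefinite_null_vector[of M W x "M *v x"] W xW by blast
  then have "A *v x = c *\<^sub>R x" by (simp add: M)
  then show thesis using that xW by blast
qed

text \<open>The orthogonal complement of finitely many eigenvectors is invariant, so the family can be
  extended one vector at a time until the dimension is exhausted.\<close>

lemma orthonormal_eigenvectors:
  fixes A :: "real ^ 'n ^ 'n"
  assumes sym: "transpose A = A" and "k \<le> CARD('n)"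
  shows "\<exists>B. finite B \<and> card B = k \<and> pairwise orthogonal B \<and>
    (\<forall>x\<in>B. norm x = 1 \<and> (\<exists>c. A *v x = c *\<^sub>R x))"
  using assms(2)
proof (induction k)
  case 0
  show ?case by (rule exI[of _ "{}"]) auto
next
  case (Suc k)
  then obtain B where B: "finite B" "card B = k" "pairwise orthogonal B"
    "\<And>x. x \<in> B \<Longrightarrow> norm x = 1 \<and> (\<exists>c. A *v x = c *\<^sub>R x)" by auto
  define W where "W = {x. \<forall>b\<in>B. orthogonal b x}"
  have W: "subspace W"
    unfolding W_def subspace_def by (auto simp: orthogonal_clauses)
  have "A *v x \<in> W" if x: "x \<in> W" for x
  proof -
    have "b \<bullet> (A *v x) = 0" if b: "b \<in> B" for b
    proof -
      obtain c where "A *v b = c *\<^sub>R b" using B(4)[OF b] by blast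
      then show ?thesis
        using x b by (simp add: symmetric_dot_commute[OF sym] W_def orthogonal_def)
    qed
    then show ?thesis by (simp add: W_def orthogonal_def)
  qed
  moreover have "dim B < DIM(real ^ 'n)"
    using dim_le_card'[OF B(1)] B(2) Suc.prems by simp
  then obtain u where "u \<noteq> 0" "\<And>y. y \<in> span B \<Longrightarrow> orthogonal u y"
    using orthogonal_to_subspace_exists[of B] by blast
  then have "u \<in> W" "u \<noteq> 0"
    by (auto simp: W_def orthogonal_commute span_base)
  ultimately obtain x c where x: "x \<in> W" "norm x = 1" "A *v x = c *\<^sub>R x"
    using eigenvector_in_invariant_subspace[OF sym W] by blast
  have xB: "x \<notin> B"
    using x by (auto simp: W_def orthogonal_self)
  show ?case
    using B x xB
    by (intro exI[of _ "insert x B"])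
      (auto simp: pairwise_insert W_def orthogonal_commute)
qed

text \<open>The spectral theorem for real symmetric matrices.\<close>

theorem orthogonal_diagonalization:
  fixes A :: "real ^ 'n ^ 'n"
  assumes sym: "transpose A = A"
  obtains P :: "real ^ 'n ^ 'n" and D
  where "orthogonal_matrix P" "transpose P ** A ** P = (\<chi> i j. if i = j then D i else 0)"
proof -
  obtain B where B: "finite B" "card B = CARD('n)" "pairwise orthogonal B"
    "\<And>x. x \<in> B \<Longrightarrow> norm x = 1 \<and> (\<exists>c. A *v x = c *\<^sub>R x)"
    using orthonormal_eigenvectors[OF sym order_refl] by auto
  obtain f where f: "bij_betw f (UNIV :: 'n set) B"
    using B(1,2) finite_same_card_bij by (metis finite)
  have fB: "f i \<in> B" for i using f by (auto simp: bij_betw_def)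
  have "\<forall>i. \<exists>c. A *v f i = c *\<^sub>R f i" using B(4) fB by blast
  then have "\<exists>D. \<forall>i. A *v f i = D i *\<^sub>R f i" by (rule choice)
  then obtain D where D: "\<And>i. A *v f i = D i *\<^sub>R f i" by auto
  define P :: "real ^ 'n ^ 'n" where "P = (\<chi> i j. f j $ i)"
  have col: "column i P = f i" for i by (simp add: column_def P_def vec_eq_iff)
  have fo: "orthogonal (f i) (f j)" if "i \<noteq> j" for i j
  proof -
    have "f i \<noteq> f j" using f that by (auto simp: bij_betw_def inj_on_def)
    then show ?thesis using pairwiseD[OF B(3) fB fB] by blast
  qed
  have oP: "orthogonal_matrix P"
    using fo fB B(4) by (simp add: orthogonal_matrix_orthonormal_columns col)
  have "(transpose P ** A ** P) $ i $ j = (if i = j then D i else 0)" for i j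
  proof -
    have "(transpose P ** A ** P) $ i $ j = (transpose P ** (A ** P)) $ i $ j"
      by (simp add: matrix_mul_assoc)
    also have "\<dots> = f i \<bullet> column j (A ** P)"
      by (simp add: matrix_matrix_mult_def inner_vec_def column_def transpose_def P_def)
    also have "column j (A ** P) = A *v f j"
      by (simp add: column_def P_def vec_eq_iff matrix_matrix_mult_def matrix_vector_mult_def)
    also have "f i \<bullet> (A *v f j) = (if i = j then D i else 0)"
      using fo[of i j] B(4)[OF fB[of i]] by (auto simp: D orthogonal_def norm_eq_1)
    finally show ?thesis .
  qed
  then have "transpose P ** A ** P = (\<chi> i j. if i = j then D i else 0)"
    by (simp add: vec_eq_iff)
  with oP show thesis using that by blast
qed

section \<open>Positive definite matrices and the log determinant\<close>

lemma trace_orthogonal_conjugate: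
  fixes A P :: "real ^ 'n ^ 'n"
  assumes "orthogonal_matrix P"
  shows "trace (transpose P ** A ** P) = trace A"
proof -
  have "trace (transpose P ** A ** P) = trace (P ** (transpose P ** A))"
    by (rule trace_mul_sym)
  also have "P ** (transpose P ** A) = A"
    using assms by (simp add: orthogonal_matrix_def matrix_mul_assoc)
  finally show ?thesis .
qed

lemma det_orthogonal_conjugate:
  fixes A P :: "real ^ 'n ^ 'n"
  assumes "orthogonal_matrix P"
  shows "det (transpose P ** A ** P) = det A"
  using det_orthogonal_matrix[OF assms] by (auto simp: det_mul det_transpose)

lemma congruence_quadratic_form:
  fixes A C :: "real ^ 'n ^ 'n"
  shows "x \<bullet> ((transpose C ** A ** C) *v x) = (C *v x) \<bullet> (A *v (C *v x))"
  by (metis dot_lmul_matrix matrix_vector_mul_assoc vector_transpose_matrix)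

lemma sym_pos_def_diag_pos:
  assumes "A \<in> sym_pos_def"
  shows "0 < A $ i $ i"
proof -
  have "0 < axis i 1 \<bullet> (A *v axis i 1)"
    using assms by (simp add: sym_pos_def_def axis_eq_0_iff)
  then show ?thesis
    by (simp add: inner_axis' inner_axis matrix_vector_mul_component)
qed

lemma sym_pos_def_congruence:
  fixes A C :: "real ^ 'n ^ 'n"
  assumes "A \<in> sym_pos_def" "invertible C"
  shows "transpose C ** A ** C \<in> sym_pos_def"
proof -
  have "C *v x \<noteq> 0" if "x \<noteq> 0" for x
    using assms(2) that matrix_left_invertible_ker invertible_def by metis
  then show ?thesis
    using assms(1) by (auto simp: sym_pos_def_def congruence_quadratic_form matrix_transpose_mul
        matrix_mul_assoc)
qed

lemma sym_pos_def_diagonalization: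
  fixes A :: "real ^ 'n ^ 'n"
  assumes A: "A \<in> sym_pos_def"
  obtains P :: "real ^ 'n ^ 'n" and D
  where "orthogonal_matrix P" "transpose P ** A ** P = (\<chi> i j. if i = j then D i else 0)"
    "\<And>i. D i > 0"
proof -
  obtain P :: "real ^ 'n ^ 'n" and D where PD: "orthogonal_matrix P"
    "transpose P ** A ** P = (\<chi> i j. if i = j then D i else 0)"
    using A by (auto simp: sym_pos_def_def intro: orthogonal_diagonalization)
  have "invertible P" using PD(1) by (auto simp: orthogonal_matrix_def invertible_def)
  then have pd: "transpose P ** A ** P \<in> sym_pos_def" using A sym_pos_def_congruence by blast
  have "D i > 0" for i
    using sym_pos_def_diag_pos[OF pd, of i] by (simp add: PD(2))
  with PD show thesis using that by blast
qed

lemma det_sym_pos_def: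
  fixes A :: "real ^ 'n ^ 'n"
  assumes "A \<in> sym_pos_def"
  shows "det A > 0"
proof -
  obtain P :: "real ^ 'n ^ 'n" and D where PD: "orthogonal_matrix P"
    "transpose P ** A ** P = (\<chi> i j. if i = j then D i else 0)" "\<And>i. D i > 0"
    by (rule sym_pos_def_diagonalization[OF assms]) (rule that)
  have "det A = det (transpose P ** A ** P)"
    by (rule det_orthogonal_conjugate[OF PD(1), symmetric])
  also have "\<dots> = (\<Prod>i\<in>UNIV. D i)"
    unfolding PD(2) by (subst det_diagonal) auto
  finally have "det A = (\<Prod>i\<in>UNIV. D i)" .
  then show ?thesis using PD(3) by (simp add: prod_pos)
qed

lemma congruence_cancel:
  fixes A B C :: "real ^ 'n ^ 'n"
  assumes "invertible C" and eq: "transpose C ** A ** C = transpose C ** B ** C"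
  shows "A = B"
proof -
  obtain C' where C': "C ** C' = mat 1"
    using assms(1) by (auto simp: invertible_def)
  have "transpose C' ** transpose C = mat 1"
    using arg_cong[OF C', of transpose] by (simp add: matrix_transpose_mul)
  then have undo: "transpose C' ** (transpose C ** X ** C) ** C' = X" for X
  proof -
    have "transpose C' ** (transpose C ** X ** C) ** C' =
        (transpose C' ** transpose C) ** X ** (C ** C')"
      by (simp only: matrix_mul_assoc)
    also have "\<dots> = X"
      by (simp only: C' \<open>transpose C' ** transpose C = mat 1\<close> matrix_mul_lid matrix_mul_rid)
    finally show ?thesis .
  qed
  have "A = transpose C' ** (transpose C ** A ** C) ** C'" by (simp only: undo)
  also have "\<dots> = B" by (simp only: eq undo)
  finally show ?thesis .
qed

text \<open>In an eigenbasis this is \<open>ln x \<le> x - 1\<close> for each eigenvalue, with equality only at \<open>x = 1\<close>.\<close>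

lemma ln_det_le_trace:
  fixes M :: "real ^ 'n ^ 'n"
  assumes M: "M \<in> sym_pos_def"
  shows "ln (det M) \<le> trace M - real CARD('n)"
    and "ln (det M) = trace M - real CARD('n) \<Longrightarrow> M = mat 1"
proof -
  obtain P :: "real ^ 'n ^ 'n" and D where PD: "orthogonal_matrix P"
    "transpose P ** M ** P = (\<chi> i j. if i = j then D i else 0)" "\<And>i. D i > 0"
    by (rule sym_pos_def_diagonalization[OF M]) (rule that)
  have "det M = det (transpose P ** M ** P)"
    by (simp only: det_orthogonal_conjugate[OF PD(1)])
  also have "\<dots> = (\<Prod>i\<in>UNIV. D i)"
    unfolding PD(2) by (subst det_diagonal) auto
  finally have det: "ln (det M) = (\<Sum>i\<in>UNIV. ln (D i))"
    using PD(3) by (simp add: ln_prod order_less_imp_not_eq2)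
  have "trace M = trace (transpose P ** M ** P)"
    by (simp only: trace_orthogonal_conjugate[OF PD(1)])
  also have "\<dots> = (\<Sum>i\<in>UNIV. D i)"
    unfolding PD(2) by (simp add: trace_def)
  finally have tr: "trace M - real CARD('n) = (\<Sum>i\<in>UNIV. D i - 1)"
    by (simp add: sum_subtractf)
  have le: "ln (D i) \<le> D i - 1" for i using PD(3) ln_le_minus_one by blast
  show "ln (det M) \<le> trace M - real CARD('n)"
    unfolding det tr by (intro sum_mono le)
  assume "ln (det M) = trace M - real CARD('n)"
  then have "(\<Sum>i\<in>UNIV. D i - 1 - ln (D i)) = 0"
    unfolding det tr by (simp add: sum_subtractf)
  then have "\<forall>i\<in>UNIV. D i - 1 - ln (D i) = 0"
    using le sum_nonneg_eq_0_iff[of UNIV "\<lambda>i. D i - 1 - ln (D i)"] by simp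
  then have "D i = 1" for i using ln_eq_minus_one[OF PD(3)[of i]] by simp
  then have "transpose P ** M ** P = mat 1" by (simp add: PD(2) mat_def vec_eq_iff)
  also have "mat 1 = transpose P ** mat 1 ** P"
    using PD(1) by (simp add: orthogonal_matrix)
  finally have "transpose P ** M ** P = transpose P ** mat 1 ** P" .
  moreover have "invertible P"
    using PD(1) by (auto simp: orthogonal_matrix_def invertible_def)
  ultimately show "M = mat 1" using congruence_cancel by blast
qed

text \<open>The matrix \<open>C\<close> is \<open>A\<close> to the power \<open>-1/2\<close> up to an orthogonal factor: an eigenbasis with the
  eigenvectors rescaled.\<close>

lemma sym_pos_def_whitening:
  fixes A :: "real ^ 'n ^ 'n"
  assumes "A \<in> sym_pos_def"
  obtains C :: "real ^ 'n ^ 'n" where "invertible C" "transpose C ** A ** C = mat 1"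
proof -
  obtain P :: "real ^ 'n ^ 'n" and D where PD: "orthogonal_matrix P"
    "transpose P ** A ** P = (\<chi> i j. if i = j then D i else 0)" "\<And>i. D i > 0"
    by (rule sym_pos_def_diagonalization[OF assms]) (rule that)
  define E :: "real ^ 'n ^ 'n" where "E = (\<chi> i j. if i = j then 1 / sqrt (D i) else 0)"
  have diag: "(\<chi> i j. if i = j then f i else 0) ** (\<chi> i j. if i = j then g i else (0::real)) =
     (\<chi> i j. if i = j then f i * g i else 0)" for f g :: "'n \<Rightarrow> real"
  proof -
    have "(\<Sum>k\<in>UNIV. (if i = k then f i else 0) * (if k = j then g k else 0)) =
        (\<Sum>k\<in>UNIV. if k = i then (if i = j then f i * g i else 0) else 0)" for i j :: 'n
      by (rule sum.cong) auto
    then show ?thesis by (simp add: vec_eq_iff matrix_matrix_mult_def)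
  qed
  have Et: "transpose E = E" by (auto simp: E_def transpose_def vec_eq_iff)
  have "transpose (P ** E) ** A ** (P ** E) = E ** (transpose P ** A ** P) ** E"
    by (simp add: matrix_transpose_mul matrix_mul_assoc Et)
  also have "\<dots> = (\<chi> i j. if i = j then 1 / sqrt (D i) * D i * (1 / sqrt (D i)) else 0)"
    unfolding PD(2) E_def diag ..
  also have "\<dots> = mat 1"
  proof -
    have "1 / sqrt (D i) * D i * (1 / sqrt (D i)) = 1" for i
      using PD(3)[of i] by (simp add: divide_simps)
    then show ?thesis by (simp add: mat_def vec_eq_iff)
  qed
  finally have "transpose (P ** E) ** A ** (P ** E) = mat 1" .
  moreover from this have "invertible (P ** E)"
    by (auto simp: invertible_left_inverse)
  ultimately show thesis using that by blast
qed

text \<open>The log determinant lies strictly below its tangent at \<open>A\<close>, whose gradient is the inverse \<open>W\<close> of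
  \<open>A\<close>. A congruence that takes \<open>A\<close> to the identity takes \<open>B\<close> to a matrix with determinant
  \<open>det B / det A\<close> and trace \<open>trace (W ** B)\<close>, so the case \<open>A = mat 1\<close> suffices.\<close>

lemma ln_det_tangent:
  fixes A B :: "real ^ 'n ^ 'n"
  assumes A: "A \<in> sym_pos_def" and B: "B \<in> sym_pos_def" and W: "W ** A = mat 1"
  shows "ln (det B) - ln (det A) \<le> trace (W ** B) - real CARD('n)"
    and "ln (det B) - ln (det A) = trace (W ** B) - real CARD('n) \<Longrightarrow> B = A"
proof -
  obtain C :: "real ^ 'n ^ 'n" where C: "invertible C" "transpose C ** A ** C = mat 1"
    by (rule sym_pos_def_whitening[OF A]) (rule that)
  define M where "M = transpose C ** B ** C"
  have M: "M \<in> sym_pos_def" unfolding M_def using sym_pos_def_congruence[OF B C(1)] .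
  have CC: "C ** transpose C = W"
  proof -
    have "C ** (transpose C ** A) = mat 1"
      using C(2) matrix_left_right_inverse by blast
    moreover have "A ** W = mat 1"
      using W matrix_left_right_inverse by blast
    then have "C ** transpose C = C ** (transpose C ** A) ** W"
      by (simp only: matrix_mul_rid flip: matrix_mul_assoc)
    ultimately show ?thesis by simp
  qed
  have "trace M = trace (C ** (transpose C ** B))"
    unfolding M_def by (rule trace_mul_sym)
  then have "trace M = trace (W ** B)"
    by (simp only: CC matrix_mul_assoc)
  moreover have "ln (det M) = ln (det B) - ln (det A)"
  proof -
    have a: "det A > 0" "det B > 0" using A B det_sym_pos_def by blast+
    have c: "det C \<noteq> 0" using C(1) invertible_det_nz by blast
    have "det A * (det C)\<^sup>2 = 1"
      using arg_cong[OF C(2), of det] by (simp add: det_mul det_transpose power2_eq_square mult_ac)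
    then have "(det C)\<^sup>2 = 1 / det A" using a by (simp add: field_simps)
    moreover have "det M = det B * (det C)\<^sup>2"
      by (simp add: M_def det_mul det_transpose power2_eq_square mult_ac)
    ultimately have "det M = det B / det A" by simp
    then show ?thesis using a by (simp add: ln_div)
  qed
  ultimately have eq: "ln (det M) = ln (det B) - ln (det A)" "trace M = trace (W ** B)" by auto
  show "ln (det B) - ln (det A) \<le> trace (W ** B) - real CARD('n)"
    using ln_det_le_trace(1)[OF M] eq by simp
  assume "ln (det B) - ln (det A) = trace (W ** B) - real CARD('n)"
  then have "M = mat 1" using ln_det_le_trace(2)[OF M] eq by simp
  then have "transpose C ** B ** C = transpose C ** A ** C" by (simp add: M_def C(2))
  then show "B = A" using congruence_cancel[OF C(1)] by blast
qed

section \<open>Optimality conditions\<close>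

lemma matrix_mult_nth:
  "(A ** B) $ i $ j = (\<Sum>k\<in>UNIV. A $ i $ k * B $ k $ j)"
  by (simp add: matrix_matrix_mult_def)

lemma trace_transpose_mult:
  fixes A B :: "real ^ 'n ^ 'n"
  shows "trace (transpose A ** B) = (\<Sum>i\<in>UNIV. \<Sum>j\<in>UNIV. A $ i $ j * B $ i $ j)"
  by (subst sum.swap) (simp add: trace_def matrix_mult_nth transpose_def)

lemma trace_mult_offdiag:
  fixes Z B :: "real ^ 'n ^ 'n"
  assumes "transpose B = B" "\<And>i. Z $ i $ i = 0"
  shows "trace (Z ** B) = (\<Sum>(i, j) | i \<noteq> j. Z $ i $ j * B $ i $ j)"
proof -
  have "trace (Z ** B) = trace (transpose B ** Z)"
    using trace_mul_sym[of Z B] assms(1) by simp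
  also have "\<dots> = (\<Sum>(i, j)\<in>UNIV. Z $ i $ j * B $ i $ j)"
    by (simp add: trace_transpose_mult sum.cartesian_product mult.commute)
  also have "\<dots> = (\<Sum>(i, j) | i \<noteq> j. Z $ i $ j * B $ i $ j)"
    using assms(2) by (intro sum.mono_neutral_right) auto
  finally show ?thesis .
qed

text \<open>The stationarity condition \<open>W = A + l *\<^sub>R Z\<close> cancels the linear terms: after the tangent inequality
  for the log determinant, the objective at \<open>B\<close> exceeds that at \<open>K\<close> by more than
  \<open>l\<close> times the gap in the subgradient inequality of the penalty, which is non-negative.\<close>

lemma glasso_kkt_sufficient:
  fixes A K W Z :: "real ^ 'p ^ 'p"
  assumes K: "K \<in> sym_pos_def" and W: "W ** K = mat 1" and stat: "W = A + l *\<^sub>R Z" and l: "l \<ge> 0"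
    and Zdiag: "\<And>i. Z $ i $ i = 0" and Zle: "\<And>i j. \<bar>Z $ i $ j\<bar> \<le> 1"
    and Zsgn: "\<And>i j. i \<noteq> j \<Longrightarrow> Z $ i $ j * K $ i $ j = \<bar>K $ i $ j\<bar>"
    and B: "B \<in> sym_pos_def" "B \<noteq> K"
  shows "glasso_objective A l K < glasso_objective A l B"
proof -
  define pen :: "real ^ 'p ^ 'p \<Rightarrow> real" where "pen M = (\<Sum>(i, j) | i \<noteq> j. \<bar>M $ i $ j\<bar>)" for M
  have tr: "trace (W ** M) = trace (A ** M) + l * trace (Z ** M)" for M
    by (simp add: stat trace_def matrix_mult_nth sum.distrib sum_distrib_left ring_distribs mult.assoc)
  have "ln (det B) - ln (det K) < trace (W ** B) - real CARD('p)"
    using ln_det_tangent[OF K B(1) W] B(2) by fastforce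
  moreover have "trace (W ** K) = real CARD('p)"
    by (simp add: W trace_I)
  moreover have "trace (Z ** B) \<le> pen B"
    unfolding pen_def
  proof (subst trace_mult_offdiag)
    have "Z $ i $ j * B $ i $ j \<le> \<bar>B $ i $ j\<bar>" for i j
      using mult_right_mono[OF Zle[of i j], of "\<bar>B $ i $ j\<bar>"] by (simp flip: abs_mult)
    then show "(\<Sum>(i, j) | i \<noteq> j. Z $ i $ j * B $ i $ j) \<le> (\<Sum>(i, j) | i \<noteq> j. \<bar>B $ i $ j\<bar>)"
      by (intro sum_mono) auto
  qed (use B Zdiag in \<open>auto simp: sym_pos_def_def\<close>)
  then have "l * trace (Z ** B) \<le> l * pen B" using l by (rule mult_left_mono)
  moreover have "trace (Z ** K) = pen K"
    unfolding pen_def using K Zdiag Zsgn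
    by (subst trace_mult_offdiag) (auto simp: sym_pos_def_def intro!: sum.cong)
  ultimately show ?thesis
    unfolding glasso_objective_def pen_def[symmetric] using tr[of B] tr[of K] by simp
qed

section \<open>Entrywise bounds for matrix products\<close>

lemma row_sum_le_inf_op_norm: "(\<Sum>j\<in>UNIV. \<bar>A $ i $ j\<bar>) \<le> inf_op_norm A"
  unfolding inf_op_norm_def by (rule Max_ge) auto

lemma inf_op_norm_pos: "A $ i $ j \<noteq> 0 \<Longrightarrow> 0 < inf_op_norm A"
  using row_sum_le_inf_op_norm[of A i] member_le_sum[of j UNIV "\<lambda>j. \<bar>A $ i $ j\<bar>"] by auto

lemma column_sum_le_inf_op_norm:
  assumes "transpose A = A"
  shows "(\<Sum>i\<in>UNIV. \<bar>A $ i $ j\<bar>) \<le> inf_op_norm A"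
proof -
  have "A $ i $ j = A $ j $ i" for i by (rule symmetric_nth[OF assms])
  then show ?thesis using row_sum_le_inf_op_norm[of A j] by simp
qed

lemma l1_norm_vectorize: "l1_norm (vectorize A) = (\<Sum>i\<in>UNIV. \<Sum>j\<in>UNIV. \<bar>A $ i $ j\<bar>)"
  by (simp add: l1_norm_def vectorize_def sum.cartesian_product case_prod_beta)

lemma abs_mult_nth_le_left:
  fixes A :: "real ^ 'n ^ 'm" and B :: "real ^ 'k ^ 'n"
  assumes "\<And>k. \<bar>B $ k $ j\<bar> \<le> b"
  shows "\<bar>(A ** B) $ i $ j\<bar> \<le> inf_op_norm A * b"
proof -
  have b: "0 \<le> b" using assms[of undefined] by linarith
  have "\<bar>(A ** B) $ i $ j\<bar> \<le> (\<Sum>k\<in>UNIV. \<bar>A $ i $ k * B $ k $ j\<bar>)"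
    unfolding matrix_mult_nth by (rule sum_abs)
  also have "\<dots> \<le> (\<Sum>k\<in>UNIV. \<bar>A $ i $ k\<bar> * b)"
    by (intro sum_mono) (simp add: abs_mult mult_left_mono assms)
  also have "\<dots> \<le> inf_op_norm A * b"
    unfolding sum_distrib_right[symmetric] using b by (intro mult_right_mono row_sum_le_inf_op_norm)
  finally show ?thesis .
qed

lemma abs_mult_nth_le_right:
  fixes A :: "real ^ 'n ^ 'm" and B :: "real ^ 'k ^ 'n"
  assumes "\<And>k. \<bar>A $ i $ k\<bar> \<le> a" "(\<Sum>k\<in>UNIV. \<bar>B $ k $ j\<bar>) \<le> b"
  shows "\<bar>(A ** B) $ i $ j\<bar> \<le> a * b"
proof -
  have a: "0 \<le> a" using assms(1)[of undefined] by linarith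
  have "\<bar>(A ** B) $ i $ j\<bar> \<le> (\<Sum>k\<in>UNIV. \<bar>A $ i $ k * B $ k $ j\<bar>)"
    unfolding matrix_mult_nth by (rule sum_abs)
  also have "\<dots> \<le> (\<Sum>k\<in>UNIV. a * \<bar>B $ k $ j\<bar>)"
    by (intro sum_mono) (simp add: abs_mult mult_right_mono assms)
  also have "\<dots> \<le> a * b"
    unfolding sum_distrib_left[symmetric] using a assms(2) by (intro mult_left_mono)
  finally show ?thesis .
qed

lemma abs_sandwich_nth_le:
  fixes K P :: "real ^ 'n ^ 'n"
  assumes "transpose K = K" "\<And>i j. \<bar>P $ i $ j\<bar> \<le> b"
  shows "\<bar>(K ** P ** K) $ i $ j\<bar> \<le> (inf_op_norm K)\<^sup>2 * b"
proof -
  have "\<bar>(K ** P ** K) $ i $ j\<bar> \<le> (inf_op_norm K * b) * inf_op_norm K"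
    using assms by (intro abs_mult_nth_le_right abs_mult_nth_le_left column_sum_le_inf_op_norm)
  then show ?thesis by (simp add: power2_eq_square mult_ac)
qed

lemma row_card_le_max_row_card: "card {j. K $ i $ j \<noteq> 0} \<le> max_row_card K"
  unfolding max_row_card_def by (rule Max_ge) auto

text \<open>Every entry of \<open>A ** K ** P\<close> is a sum over all entries of \<open>K\<close>, each weighted by one entry of \<open>A\<close>
  and one of \<open>P\<close>.\<close>

lemma contraction_l1:
  fixes A K P :: "real ^ 'n ^ 'n"
  assumes A: "\<And>i j. \<bar>A $ i $ j\<bar> \<le> a" and P: "\<And>i j. \<bar>P $ i $ j\<bar> \<le> b"
  shows "\<bar>(A ** K ** P) $ i $ j\<bar> \<le> a * (l1_norm (vectorize K) * b)"
proof -
  have a: "0 \<le> a" using A[of undefined undefined] by linarith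
  have "(\<Sum>k\<in>UNIV. \<bar>(K ** P) $ k $ j\<bar>) \<le> (\<Sum>k\<in>UNIV. (\<Sum>l\<in>UNIV. \<bar>K $ k $ l\<bar>) * b)"
  proof (rule sum_mono)
    fix k
    have "\<bar>(K ** P) $ k $ j\<bar> \<le> (\<Sum>l\<in>UNIV. \<bar>K $ k $ l * P $ l $ j\<bar>)"
      unfolding matrix_mult_nth by (rule sum_abs)
    also have "\<dots> \<le> (\<Sum>l\<in>UNIV. \<bar>K $ k $ l\<bar> * b)"
      by (intro sum_mono) (simp add: abs_mult mult_left_mono P)
    finally show "\<bar>(K ** P) $ k $ j\<bar> \<le> (\<Sum>l\<in>UNIV. \<bar>K $ k $ l\<bar>) * b"
      by (simp add: sum_distrib_right)
  qed
  also have "\<dots> = l1_norm (vectorize K) * b"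
    by (simp add: l1_norm_vectorize sum_distrib_right)
  finally show ?thesis
    unfolding matrix_mul_assoc[symmetric] using A by (intro abs_mult_nth_le_right)
qed

text \<open>Symmetry of \<open>K\<close> turns the row count \<open>max_row_card K\<close> into a bound on the number of non-zero
  entries in each column of \<open>Delta\<close>.\<close>

lemma contraction_sparse:
  fixes A K Delta Sigma :: "real ^ 'n ^ 'n"
  assumes sym: "transpose K = K" "transpose Sigma = Sigma"
    and supp: "\<And>i j. K $ i $ j = 0 \<Longrightarrow> Delta $ i $ j = 0"
    and A: "\<And>i j. \<bar>A $ i $ j\<bar> \<le> a" and D: "\<And>i j. \<bar>Delta $ i $ j\<bar> \<le> b"
  shows "\<bar>(A ** Delta ** Sigma) $ i $ j\<bar> \<le> a * (real (max_row_card K) * b * inf_op_norm Sigma)"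
proof -
  have a: "0 \<le> a" using A[of undefined undefined] by linarith
  have b: "0 \<le> b" using D[of undefined undefined] by linarith
  have Ks: "K $ k $ l = K $ l $ k" for k l by (rule symmetric_nth[OF sym(1)])
  have "(\<Sum>k\<in>UNIV. \<bar>Delta $ k $ l\<bar>) \<le> real (max_row_card K) * b" for l
  proof -
    have "(\<Sum>k\<in>UNIV. \<bar>Delta $ k $ l\<bar>) = (\<Sum>k | K $ l $ k \<noteq> 0. \<bar>Delta $ k $ l\<bar>)"
      using supp Ks by (intro sum.mono_neutral_right) auto
    also have "\<dots> \<le> (\<Sum>k | K $ l $ k \<noteq> 0. b)"
      by (intro sum_mono D)
    also have "\<dots> = real (card {k. K $ l $ k \<noteq> 0}) * b" by simp
    also have "\<dots> \<le> real (max_row_card K) * b"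
      using b row_card_le_max_row_card by (intro mult_right_mono of_nat_mono)
    finally show ?thesis .
  qed
  then have "\<bar>(A ** Delta) $ i $ l\<bar> \<le> a * (real (max_row_card K) * b)" for l
    using A by (intro abs_mult_nth_le_right)
  then have "\<bar>(A ** Delta ** Sigma) $ i $ j\<bar> \<le> a * (real (max_row_card K) * b) * inf_op_norm Sigma"
    by (rule abs_mult_nth_le_right[OF _ column_sum_le_inf_op_norm[OF sym(2)]])
  then show ?thesis by (simp add: mult_ac)
qed

section \<open>Perturbation of the inverse\<close>

lemma obtain_max_entry:
  fixes A :: "real ^ 'n ^ 'm"
  obtains i j where "\<And>k l. \<bar>A $ k $ l\<bar> \<le> \<bar>A $ i $ j\<bar>"
proof -
  let ?m = "\<lambda>p. \<bar>A $ fst p $ snd p\<bar>"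
  have "Max (range ?m) \<in> range ?m" by (rule Max_in) auto
  then obtain p where "Max (range ?m) = ?m p" by (rule rangeE)
  moreover have "?m (k, l) \<le> Max (range ?m)" for k l
    by (rule Max_ge) (simp, rule rangeI)
  ultimately have "\<bar>A $ k $ l\<bar> \<le> ?m p" for k l by simp
  then show thesis using that by blast
qed

lemma matrix_mult_distrib_right:
  fixes A B C :: "real ^ 'n ^ 'n"
  shows "(A + B) ** C = A ** C + B ** C" "(A - B) ** C = A ** C - B ** C"
  by (simp_all add: vec_eq_iff matrix_mult_nth algebra_simps sum.distrib sum_subtractf)

lemma matrix_sub_ldistrib:
  fixes A B C :: "real ^ 'n ^ 'n"
  shows "A ** (B - C) = A ** B - A ** C"
  by (simp add: vec_eq_iff matrix_mult_nth algebra_simps sum_subtractf)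

text \<open>Right multiplication by \<open>X\<close> scales the largest absolute entry by at most \<open>c\<close>. The perturbation of the
  inverse rests on this property of \<open>Delta ** Sigma\<close> alone, so the two estimates behind \<open>\<eta>\<close> enter
  it in the same way.\<close>

definition entry_contraction :: "real \<Rightarrow> real ^ 'n ^ 'n \<Rightarrow> bool" where
  "entry_contraction c X \<longleftrightarrow>
    (\<forall>A a. (\<forall>i j. \<bar>(A :: real ^ 'n ^ 'n) $ i $ j\<bar> \<le> a) \<longrightarrow> (\<forall>i j. \<bar>(A ** X) $ i $ j\<bar> \<le> a * c))"

lemma entry_contractionD:
  fixes A X :: "real ^ 'n ^ 'n"
  assumes "entry_contraction c X" "\<And>i j. \<bar>A $ i $ j\<bar> \<le> a"
  shows "\<bar>(A ** X) $ i $ j\<bar> \<le> a * c"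
  using assms unfolding entry_contraction_def by blast

lemma matrix_scaleR_mult:
  fixes A B :: "real ^ 'n ^ 'n"
  shows "(s *\<^sub>R A) ** B = s *\<^sub>R (A ** B)" "A ** (s *\<^sub>R B) = s *\<^sub>R (A ** B)"
  by (simp_all add: vec_eq_iff matrix_mult_nth sum_distrib_left mult_ac)

lemma entry_contraction_scale:
  fixes X :: "real ^ 'n ^ 'n"
  assumes X: "entry_contraction c X" and s: "0 \<le> s" "s \<le> 1"
  shows "entry_contraction c (s *\<^sub>R X)"
  unfolding entry_contraction_def
proof (intro allI impI)
  fix A :: "real ^ 'n ^ 'n" and a i j
  assume "\<forall>i j. \<bar>A $ i $ j\<bar> \<le> a"
  then have "\<bar>(A ** X) $ i $ j\<bar> \<le> a * c" using X unfolding entry_contraction_def by blast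
  then have "s * \<bar>(A ** X) $ i $ j\<bar> \<le> 1 * (a * c)"
    using s by (intro mult_mono) auto
  then show "\<bar>(A ** s *\<^sub>R X) $ i $ j\<bar> \<le> a * c"
    using s by (simp add: matrix_scaleR_mult abs_mult)
qed

text \<open>At a position where \<open>\<bar>E\<bar>\<close> is largest, the equation gives \<open>m \<le> b + m * c\<close> for that maximum \<open>m\<close>.\<close>

lemma entry_contraction_bound:
  fixes E X :: "real ^ 'n ^ 'n"
  assumes X: "entry_contraction c X" and c: "c < 1"
    and E: "E = - P - E ** X" and P: "\<And>i j. \<bar>P $ i $ j\<bar> \<le> b"
  shows "\<bar>E $ i $ j\<bar> \<le> b / (1 - c)"
proof -
  obtain k l where max: "\<And>i j. \<bar>E $ i $ j\<bar> \<le> \<bar>E $ k $ l\<bar>" by (rule obtain_max_entry[of E]) (rule that)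
  have "E $ k $ l = - P $ k $ l - (E ** X) $ k $ l" by (subst E) simp
  then have "\<bar>E $ k $ l\<bar> \<le> b + \<bar>E $ k $ l\<bar> * c"
    using P[of k l] entry_contractionD[OF X max, of k l] by linarith
  then have "\<bar>E $ k $ l\<bar> \<le> b / (1 - c)" using c by (simp add: field_simps)
  then show ?thesis using max[of i j] by linarith
qed

text \<open>\<open>K + Delta\<close> is \<open>mat 1 + Delta ** Sigma\<close> times \<open>K\<close>. A row vector that annihilates the first factor
  is reproduced, up to sign, by a contraction and hence vanishes.\<close>

lemma invertible_of_entry_contraction:
  fixes K Sigma Delta :: "real ^ 'n ^ 'n"
  assumes sym: "transpose (K + Delta) = K + Delta" and inv: "K ** Sigma = mat 1"
    and X: "entry_contraction c (Delta ** Sigma)" and c: "c < 1"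
  shows "invertible (K + Delta)"
proof -
  have "x = 0" if x: "(K + Delta) *v x = 0" for x
  proof -
    \<comment> \<open>Contraction is a statement about square matrices, so the row vector is repeated in every row.\<close>
    define A :: "real ^ 'n ^ 'n" where "A = (\<chi> i. x)"
    have "(A ** (K + Delta)) $ i $ j = ((K + Delta) *v x) $ j" for i j
    proof -
      have "(K + Delta) $ k $ j = (K + Delta) $ j $ k" for k
        by (rule symmetric_nth[OF sym])
      then show ?thesis
        by (simp add: matrix_mult_nth matrix_vector_mult_def A_def mult.commute)
    qed
    then have "A ** (K + Delta) = 0" using x by (simp add: vec_eq_iff)
    then have "A ** (K + Delta) ** Sigma = 0" by (simp add: vec_eq_iff matrix_mult_nth)
    then have "A + A ** (Delta ** Sigma) = 0"
      by (simp add: matrix_add_ldistrib matrix_mult_distrib_right inv flip: matrix_mul_assoc)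
    then have "A = - 0 - A ** (Delta ** Sigma)" by (simp add: eq_neg_iff_add_eq_0)
    then have "\<bar>A $ i $ j\<bar> \<le> 0 / (1 - c)" for i j
      by (rule entry_contraction_bound[OF X c]) simp
    then show "x = 0" by (simp add: A_def vec_eq_iff)
  qed
  then have "\<forall>x. (K + Delta) *v x = 0 \<longrightarrow> x = 0" by (intro allI impI)
  then show ?thesis
    by (simp only: invertible_left_inverse matrix_left_invertible_ker)
qed

lemma matrix_inv_both:
  fixes A :: "real ^ 'n ^ 'n"
  assumes "invertible A"
  shows "A ** matrix_inv A = mat 1" "matrix_inv A ** A = mat 1"
  using someI_ex[OF assms[unfolded invertible_def]] unfolding matrix_inv_def by auto

text \<open>The second resolvent identity: \<open>W - Sigma = - (W ** Delta ** Sigma)\<close>, with \<open>W\<close> on the right-hand side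
  split as \<open>Sigma + (W - Sigma)\<close>.\<close>

lemma matrix_inv_perturbation:
  fixes K Sigma Delta W :: "real ^ 'n ^ 'n"
  assumes inv: "K ** Sigma = mat 1" and W: "W ** (K + Delta) = mat 1"
  shows "W - Sigma = - (Sigma ** Delta ** Sigma) - (W - Sigma) ** (Delta ** Sigma)"
proof -
  have "W ** (K + Delta) ** Sigma = Sigma" by (simp add: W)
  then have "W + W ** (Delta ** Sigma) = Sigma"
    by (simp add: matrix_add_ldistrib matrix_mult_distrib_right inv flip: matrix_mul_assoc)
  then show ?thesis
    by (simp add: matrix_mult_distrib_right matrix_mul_assoc algebra_simps)
qed

lemma continuous_on_matrix_mult:
  fixes f g :: "'a::topological_space \<Rightarrow> real ^ 'n ^ 'n"
  assumes "continuous_on S f" "continuous_on S g"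
  shows "continuous_on S (\<lambda>x. f x ** g x)"
  unfolding matrix_matrix_mult_def using assms
  by (intro continuous_on_vec_lambda continuous_intros)

lemma continuous_on_det:
  fixes f :: "'a::topological_space \<Rightarrow> real ^ 'n ^ 'n"
  assumes "continuous_on S f"
  shows "continuous_on S (\<lambda>x. det (f x))"
  unfolding det_def using assms by (intro continuous_intros)

lemma matrix_inv_cramer:
  fixes A :: "real ^ 'n ^ 'n"
  assumes "invertible A"
  shows "matrix_inv A $ k $ j = det (\<chi> i l. if l = k then mat 1 $ i $ j else A $ i $ l) / det A"
proof -
  have "A *v column j (matrix_inv A) = column j (mat 1)"
    unfolding matrix_inv_both(1)[OF assms, symmetric]
    by (simp add: vec_eq_iff column_def matrix_vector_mult_def matrix_mult_nth)
  then have "column j (matrix_inv A) = (\<chi> k. det (\<chi> i l. if l = k then column j (mat 1) $ i else A $ i $ l) / det A)"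
    using cramer[of A] assms invertible_det_nz by blast
  from arg_cong[OF this, of "\<lambda>v. v $ k"] show ?thesis
    by (simp add: column_def cong: if_cong)
qed

text \<open>By Cramer's rule the entries of the inverse are quotients of determinants.\<close>

lemma continuous_on_matrix_inv:
  fixes f :: "'a::topological_space \<Rightarrow> real ^ 'n ^ 'n"
  assumes f: "continuous_on S f" and inv: "\<And>x. x \<in> S \<Longrightarrow> invertible (f x)"
  shows "continuous_on S (\<lambda>x. matrix_inv (f x))"
proof -
  have "continuous_on S (\<lambda>x. \<chi> k j. det (\<chi> i l. if l = k then mat 1 $ i $ j else f x $ i $ l) / det (f x))"
  proof (intro continuous_on_vec_lambda continuous_on_divide continuous_on_det f)
    fix i l k j :: 'n
    show "continuous_on S (\<lambda>x. if l = k then mat 1 $ i $ j else f x $ i $ l)"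
      by (cases "l = k") (simp_all add: continuous_on_component f)
  qed (use inv invertible_det_nz in blast)
  moreover have "matrix_inv (f x) =
      (\<chi> k j. det (\<chi> i l. if l = k then mat 1 $ i $ j else f x $ i $ l) / det (f x))" if "x \<in> S" for x
    using matrix_inv_cramer[OF inv[OF that]] by (simp add: vec_eq_iff)
  ultimately show ?thesis by (subst continuous_on_cong[OF refl]) auto
qed

text \<open>Let \<open>- \<mu>\<close> be the minimum of \<open>x \<bullet> Delta x / x \<bullet> K x\<close>. Then \<open>Delta + \<mu> *\<^sub>R K\<close> is positive semidefinite and
  singular, so \<open>\<mu> \<ge> 1\<close> would make the matrix at \<open>s = 1 / \<mu>\<close> on the segment singular; and \<open>\<mu> < 1\<close>
  means that \<open>K + Delta\<close> is positive definite.\<close>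

lemma sym_pos_def_of_invertible_segment:
  fixes K Delta :: "real ^ 'n ^ 'n"
  assumes K: "K \<in> sym_pos_def" and Delta: "transpose Delta = Delta"
    and inv: "\<And>s. 0 < s \<Longrightarrow> s \<le> 1 \<Longrightarrow> invertible (K + s *\<^sub>R Delta)"
  shows "K + Delta \<in> sym_pos_def"
proof -
  define r where "r x = (x \<bullet> (Delta *v x)) / (x \<bullet> (K *v x))" for x
  have Kpos: "x \<bullet> (K *v x) > 0" if "x \<noteq> 0" for x
    using K that by (simp add: sym_pos_def_def)
  have Ks: "transpose K = K" using K by (simp add: sym_pos_def_def)
  have ne: "\<forall>x\<in>sphere 0 1. x \<bullet> (K *v x) \<noteq> 0"
  proof
    fix x :: "real ^ 'n" assume "x \<in> sphere 0 1"
    then have "x \<noteq> 0" by auto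
    then show "x \<bullet> (K *v x) \<noteq> 0" using Kpos[of x] by simp
  qed
  have "continuous_on (sphere 0 1) r"
    unfolding r_def
    using ne by (intro continuous_intros linear_continuous_on) (simp_all flip: linear_conv_bounded_linear)
  moreover have "sphere (0 :: real ^ 'n) 1 \<noteq> {}" by simp
  ultimately obtain x where x: "x \<in> sphere 0 1" and min: "\<And>y. y \<in> sphere 0 1 \<Longrightarrow> r x \<le> r y"
    using continuous_attains_inf[OF compact_sphere] by metis
  define \<mu> where "\<mu> = - r x"
  define M where "M = Delta + \<mu> *\<^sub>R K"
  have M: "M *v y = Delta *v y + \<mu> *\<^sub>R (K *v y)" for y
    by (simp add: M_def matrix_vector_mult_add_rdistrib flip: scaleR_matrix_vector_assoc)
  have x0: "x \<noteq> 0" using x by auto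
  have low: "- \<mu> * (y \<bullet> (K *v y)) \<le> y \<bullet> (Delta *v y)" for y
  proof (cases "y = 0")
    case False
    have "r x \<le> r (y /\<^sub>R norm y)" using False by (intro min) simp
    also have "\<dots> = r y"
      using False by (simp add: r_def matrix_vector_mult_scaleR)
    finally show ?thesis using Kpos[OF False] by (simp add: \<mu>_def r_def field_simps)
  qed simp
  have "x \<bullet> (M *v x) = 0"
    using Kpos[OF x0] by (simp add: M inner_add_right inner_diff_right \<mu>_def r_def)
  moreover have "0 \<le> y \<bullet> (M *v y)" for y
    using low[of y] by (simp add: M inner_add_right)
  moreover have Mt: "transpose M = M"
    using Delta Ks by (simp add: M_def vec_eq_iff transpose_def)
  ultimately have "(M *v x) \<bullet> (M *v x) = 0"
    using semidefinite_null_vector[of M UNIV x "M *v x"] by simp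
  then have Mx: "M *v x = 0" by simp
  have "\<mu> < 1"
  proof (rule ccontr)
    assume "\<not> \<mu> < 1"
    then have mu: "\<mu> \<ge> 1" by simp
    have "(K + (1 / \<mu>) *\<^sub>R Delta) *v x = (1 / \<mu>) *\<^sub>R (M *v x)"
      using mu by (simp add: M matrix_vector_mult_add_rdistrib scaleR_add_right flip: scaleR_matrix_vector_assoc)
    then have "(K + (1 / \<mu>) *\<^sub>R Delta) *v x = 0" by (simp add: Mx)
    moreover have "invertible (K + (1 / \<mu>) *\<^sub>R Delta)" using mu by (intro inv) auto
    ultimately show False
      using x0 matrix_left_invertible_ker unfolding invertible_left_inverse by blast
  qed
  have "0 < y \<bullet> ((K + Delta) *v y)" if y: "y \<noteq> 0" for y
  proof -
    have "0 < (1 - \<mu>) * (y \<bullet> (K *v y))" using Kpos[OF y] \<open>\<mu> < 1\<close> by simp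
    also have "\<dots> \<le> y \<bullet> ((K + Delta) *v y)"
      using low[of y] by (simp add: matrix_vector_mult_add_rdistrib inner_add_right algebra_simps)
    finally show ?thesis .
  qed
  moreover have "transpose (K + Delta) = K + Delta"
    using Delta Ks by (simp add: vec_eq_iff transpose_def)
  ultimately show ?thesis by (simp add: sym_pos_def_def)
qed

section \<open>The linearized equation on the support\<close>

lemma submatrix_diagonal_vec:
  fixes x :: "real ^ 'n"
  shows "(submatrix S S (mat 1) *v x) $ i = (if i \<in> S then x $ i else 0)"
proof -
  have "(submatrix S S (mat 1) *v x) $ i = (\<Sum>j\<in>UNIV. if j = i then (if i \<in> S then x $ i else 0) else 0)"
    unfolding matrix_vector_mult_def vec_lambda_beta
    by (intro sum.cong) (auto simp: submatrix_def mat_def)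
  then show ?thesis by simp
qed

lemma submatrix_nth: "submatrix R C A $ i $ j = (if i \<in> R \<and> j \<in> C then A $ i $ j else 0)"
  by (simp add: submatrix_def)

lemma submatrix_supported_vec:
  fixes x :: "real ^ 'n" and A :: "real ^ 'n ^ 'm"
  assumes "\<And>i. i \<notin> S \<Longrightarrow> x $ i = 0"
  shows "(submatrix R S A *v x) $ i = (if i \<in> R then (A *v x) $ i else 0)"
  using assms by (auto simp: matrix_vector_mult_def submatrix_def intro!: sum.cong sum.neutral)

text \<open>A block that is injective on vectors supported on \<open>S\<close> has an inverse. Completing the block by the
  identity on the complement of \<open>S\<close> gives an injective, hence invertible, matrix \<open>M\<close> that
  commutes with the projection \<open>U\<close> onto the coordinates in \<open>S\<close>; the inverse of the block is the
  compression of the inverse of \<open>M\<close>.\<close>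

lemma is_submatrix_inv_submatrix_inv:
  fixes A :: "real ^ 'n ^ 'n"
  assumes inj: "\<And>x. (\<And>i. i \<notin> S \<Longrightarrow> x $ i = 0) \<Longrightarrow> (\<And>i. i \<in> S \<Longrightarrow> (A *v x) $ i = 0) \<Longrightarrow> x = 0"
  shows "is_submatrix_inv S A (submatrix_inv S A)"
proof -
  define U :: "real ^ 'n ^ 'n" where "U = submatrix S S (mat 1)"
  define G where "G = submatrix S S A"
  define M where "M = G + (mat 1 - U)"
  have UU: "U ** U = U" and UG: "U ** G = G" and GU: "G ** U = G"
    unfolding U_def G_def by (rule submatrix_unit_left submatrix_unit_right)+
  have MU: "M ** U = G" "U ** M = G"
    by (simp_all add: M_def matrix_mult_distrib_right matrix_add_ldistrib matrix_sub_ldistrib UU UG GU)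
  have "x = 0" if x: "M *v x = 0" for x
  proof -
    have Mx: "(G *v x) $ i + (x $ i - (if i \<in> S then x $ i else 0)) = 0" for i
      using arg_cong[OF x, of "\<lambda>v. v $ i"] unfolding M_def U_def
      by (simp add: matrix_vector_mult_add_rdistrib matrix_vector_mult_diff_rdistrib
          submatrix_diagonal_vec del: if_split)
    have off: "x $ i = 0" if "i \<notin> S" for i
    proof -
      have "(G *v x) $ i = 0" using that by (simp add: G_def submatrix_def matrix_vector_mult_def)
      then show ?thesis using Mx[of i] that by simp
    qed
    have "(A *v x) $ i = 0" if "i \<in> S" for i
      using Mx[of i] that submatrix_supported_vec[of S x S A i] off by (simp add: G_def)
    with off show "x = 0" by (rule inj)
  qed
  then have "\<forall>x. M *v x = 0 \<longrightarrow> x = 0" by (intro allI impI)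
  then have "invertible M"
    by (simp only: invertible_left_inverse matrix_left_invertible_ker)
  then have inv: "M ** matrix_inv M = mat 1" "matrix_inv M ** M = mat 1"
    by (rule matrix_inv_both)+
  define N where "N = matrix_inv M"
  have NU: "N ** U = U ** N"
  proof -
    have "N ** U = N ** (U ** M) ** N"
      using inv(1) by (simp add: N_def flip: matrix_mul_assoc)
    also have "\<dots> = N ** (M ** U) ** N" by (simp add: MU)
    also have "\<dots> = U ** N"
      using inv(2) by (simp add: N_def matrix_mul_assoc)
    finally show ?thesis .
  qed
  have UX: "submatrix S S X = U ** X ** U" for X
  proof -
    have "(U ** X) $ i $ j = (if i \<in> S then X $ i $ j else 0)" for X :: "real ^ 'n ^ 'n" and i j
      using submatrix_diagonal_vec[of S "column j X" i]
      by (simp add: U_def matrix_mult_nth matrix_vector_mult_def column_def)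
    moreover have "(X ** U) $ i $ j = (if j \<in> S then X $ i $ j else 0)" for X :: "real ^ 'n ^ 'n" and i j
    proof -
      have "(X ** U) $ i $ j = (\<Sum>k\<in>UNIV. if k = j then (if j \<in> S then X $ i $ j else 0) else 0)"
        unfolding matrix_mult_nth U_def by (intro sum.cong) (auto simp: submatrix_def mat_def)
      then show ?thesis by simp
    qed
    ultimately show ?thesis by (simp add: vec_eq_iff submatrix_def)
  qed
  have "is_submatrix_inv S A (N ** U)"
    unfolding is_submatrix_inv_def G_def[symmetric] U_def[symmetric]
  proof (intro conjI)
    show "submatrix S S (N ** U) = N ** U"
      unfolding UX by (metis NU UU matrix_mul_assoc)
    have "G ** (N ** U) = U ** (M ** N) ** U"
      by (simp add: MU matrix_mul_assoc)
    then show "G ** (N ** U) = U" by (simp add: N_def inv UU)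
    have "N ** U ** G = (N ** M) ** U"
      by (metis MU UG matrix_mul_assoc)
    then show "N ** U ** G = U" by (simp add: N_def inv)
  qed
  then show ?thesis by (simp add: submatrix_inv_eqI)
qed

lemma sym_pos_def_factor:
  fixes A :: "real ^ 'n ^ 'n"
  assumes "A \<in> sym_pos_def"
  obtains F :: "real ^ 'n ^ 'n" where "invertible F" "F ** transpose F = A"
proof -
  obtain C :: "real ^ 'n ^ 'n" where C: "invertible C" "transpose C ** A ** C = mat 1"
    by (rule sym_pos_def_whitening[OF assms]) (rule that)
  define H where "H = matrix_inv C"
  have H: "C ** H = mat 1" "H ** C = mat 1"
    unfolding H_def using matrix_inv_both[OF C(1)] by auto
  have "transpose C ** (transpose H ** H) ** C = transpose (H ** C) ** (H ** C)"
    by (simp only: matrix_transpose_mul matrix_mul_assoc)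
  also have "\<dots> = transpose C ** A ** C" by (simp add: H C(2))
  finally have "transpose H ** H = A" by (rule congruence_cancel[OF C(1)])
  moreover have "invertible (transpose H)"
    unfolding invertible_left_inverse using arg_cong[OF H(2), of transpose]
    by (auto simp: matrix_transpose_mul intro: exI[of _ "transpose C"])
  ultimately show thesis using that[of "transpose H"] by simp
qed

text \<open>The form \<open>trace (transpose D ** (Sigma ** D ** Sigma))\<close> is the quadratic form of the Kronecker product of
  \<open>Sigma\<close> with itself. With \<open>Sigma = C ** transpose C\<close> it is the squared Frobenius norm of
  \<open>transpose C ** D ** C\<close>.\<close>

lemma trace_sandwich_definite:
  fixes Sigma D :: "real ^ 'n ^ 'n"
  assumes Sigma: "Sigma \<in> sym_pos_def" and tr: "trace (transpose D ** (Sigma ** D ** Sigma)) = 0"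
  shows "D = 0"
proof -
  obtain C :: "real ^ 'n ^ 'n" where C: "invertible C" and CC: "C ** transpose C = Sigma"
    by (rule sym_pos_def_factor[OF Sigma]) (rule that)
  define N where "N = transpose C ** D ** C"
  have "trace (transpose D ** (Sigma ** D ** Sigma)) = trace ((transpose D ** C ** transpose C ** D ** C) ** transpose C)"
    by (simp add: matrix_mul_assoc flip: CC)
  also have "\<dots> = trace (transpose C ** (transpose D ** C ** transpose C ** D ** C))"
    by (rule trace_mul_sym)
  also have "\<dots> = trace (transpose N ** N)"
    by (simp add: N_def matrix_transpose_mul matrix_mul_assoc)
  also have "\<dots> = (\<Sum>i\<in>UNIV. \<Sum>j\<in>UNIV. (N $ i $ j)\<^sup>2)"
    by (simp add: trace_transpose_mult power2_eq_square)
  finally have "(\<Sum>i\<in>UNIV. \<Sum>j\<in>UNIV. (N $ i $ j)\<^sup>2) = 0" using tr by simp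
  then have "N $ i $ j = 0" for i j
    by (simp add: sum_nonneg_eq_0_iff sum_nonneg)
  then have "N = transpose C ** 0 ** C"
    by (simp add: vec_eq_iff matrix_mult_nth)
  then show "D = 0" unfolding N_def by (rule congruence_cancel[OF C])
qed

definition matrix_of_vec :: "real ^ ('m \<times> 'n) \<Rightarrow> real ^ 'n ^ 'm" where
  "matrix_of_vec x = (\<chi> i j. x $ (i, j))"

lemma vectorize_matrix_of_vec [simp]: "vectorize (matrix_of_vec x) = x"
  by (simp add: vectorize_def matrix_of_vec_def vec_eq_iff)

lemma vectorize_nth: "vectorize A $ (i, j) = A $ i $ j"
  by (simp add: vectorize_def)

text \<open>Positive definiteness of the Kronecker product passes to its principal block on \<open>S\<close>.\<close>

lemma kronecker_supported_inj:
  fixes Sigma D :: "real ^ 'p ^ 'p"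
  assumes Sigma: "Sigma \<in> sym_pos_def"
    and supp: "\<And>i j. (i, j) \<notin> S \<Longrightarrow> D $ i $ j = 0"
    and zero: "\<And>i j. (i, j) \<in> S \<Longrightarrow> (Sigma ** D ** Sigma) $ i $ j = 0"
  shows "D = 0"
proof (rule trace_sandwich_definite[OF Sigma])
  have "D $ i $ j * (Sigma ** D ** Sigma) $ i $ j = 0" for i j
    using supp zero by (cases "(i, j) \<in> S") auto
  then show "trace (transpose D ** (Sigma ** D ** Sigma)) = 0"
    by (simp only: trace_transpose_mult sum.neutral_const)
qed

lemma infnorm_vectorize_le_iff:
  fixes A :: "real ^ 'n ^ 'm"
  shows "infnorm (vectorize A) \<le> b \<longleftrightarrow> (\<forall>i j. \<bar>A $ i $ j\<bar> \<le> b)"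
proof
  assume "infnorm (vectorize A) \<le> b"
  then show "\<forall>i j. \<bar>A $ i $ j\<bar> \<le> b"
    using component_le_infnorm_cart[of "vectorize A"] by (auto simp flip: vectorize_nth intro: order_trans)
next
  assume "\<forall>i j. \<bar>A $ i $ j\<bar> \<le> b"
  then show "infnorm (vectorize A) \<le> b"
    unfolding infnorm_cart by (intro cSup_least) (auto simp: vectorize_nth)
qed

text \<open>The unique matrix \<open>D\<close> supported on \<open>S\<close> for which \<open>A ** D ** A\<close> and \<open>Q\<close> agree on \<open>S\<close>, for positive
  definite \<open>A\<close>.\<close>

definition supported_solution ::
  "real ^ 'p ^ 'p \<Rightarrow> ('p \<times> 'p) set \<Rightarrow> real ^ 'p ^ 'p \<Rightarrow> real ^ 'p ^ 'p" where
  "supported_solution A S Q = matrix_of_vec (submatrix_inv S (kronecker A A) *v vectorize Q)"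

lemma kronecker_sym_vectorize:
  fixes Sigma D :: "real ^ 'p ^ 'p"
  assumes "Sigma \<in> sym_pos_def"
  shows "kronecker Sigma Sigma *v vectorize D = vectorize (Sigma ** D ** Sigma)"
  using assms by (simp add: kronecker_vectorize sym_pos_def_def)

lemma is_submatrix_inv_kronecker:
  fixes Sigma :: "real ^ 'p ^ 'p"
  assumes Sigma: "Sigma \<in> sym_pos_def"
  shows "is_submatrix_inv S (kronecker Sigma Sigma) (submatrix_inv S (kronecker Sigma Sigma))"
proof (rule is_submatrix_inv_submatrix_inv)
  fix x :: "real ^ ('p \<times> 'p)"
  assume x: "\<And>p. p \<notin> S \<Longrightarrow> x $ p = 0" "\<And>p. p \<in> S \<Longrightarrow> (kronecker Sigma Sigma *v x) $ p = 0"
  have "kronecker Sigma Sigma *v x = vectorize (Sigma ** matrix_of_vec x ** Sigma)"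
    using kronecker_sym_vectorize[OF Sigma, of "matrix_of_vec x"] by simp
  with x(2) have "(Sigma ** matrix_of_vec x ** Sigma) $ i $ j = 0" if "(i, j) \<in> S" for i j
    using that by (simp flip: vectorize_nth)
  then have "matrix_of_vec x = 0"
    using x(1) by (intro kronecker_supported_inj[OF Sigma, of S]) (auto simp: matrix_of_vec_def)
  then show "x = 0" by (simp add: matrix_of_vec_def vec_eq_iff)
qed

lemma supported_solution_outside:
  fixes Sigma Q :: "real ^ 'p ^ 'p"
  assumes Sigma: "Sigma \<in> sym_pos_def" and "(i, j) \<notin> S"
  shows "supported_solution Sigma S Q $ i $ j = 0"
proof -
  let ?B = "submatrix_inv S (kronecker Sigma Sigma)"
  have "submatrix S S ?B = ?B"
    using is_submatrix_inv_kronecker[OF Sigma] by (simp add: is_submatrix_inv_def)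
  then have "?B $ (i, j) $ q = submatrix S S ?B $ (i, j) $ q" for q by (simp only:)
  then have "?B $ (i, j) $ q = 0" for q using assms(2) by (simp only: submatrix_nth) simp
  then show ?thesis
    by (simp add: supported_solution_def matrix_of_vec_def matrix_vector_mult_def)
qed

lemma supported_solution_inside:
  fixes Sigma Q :: "real ^ 'p ^ 'p"
  assumes Sigma: "Sigma \<in> sym_pos_def" and ij: "(i, j) \<in> S"
  shows "(Sigma ** supported_solution Sigma S Q ** Sigma) $ i $ j = Q $ i $ j"
proof -
  let ?G = "kronecker Sigma Sigma"
  let ?B = "submatrix_inv S ?G"
  let ?x = "?B *v vectorize Q"
  have x: "?x = vectorize (supported_solution Sigma S Q)" by (simp add: supported_solution_def)
  have "(Sigma ** supported_solution Sigma S Q ** Sigma) $ i $ j = (?G *v ?x) $ (i, j)"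
    unfolding x kronecker_sym_vectorize[OF Sigma] by (simp add: vectorize_nth)
  also have "\<dots> = (submatrix S S ?G *v ?x) $ (i, j)"
    using ij supported_solution_outside[OF Sigma, of _ _ S Q]
    by (subst submatrix_supported_vec) (auto simp: x vectorize_nth)
  also have "\<dots> = (submatrix S S (mat 1) *v vectorize Q) $ (i, j)"
    using is_submatrix_inv_kronecker[OF Sigma, of S]
    by (simp add: matrix_vector_mul_assoc is_submatrix_inv_def)
  also have "\<dots> = Q $ i $ j" using ij by (simp add: submatrix_diagonal_vec vectorize_nth)
  finally show ?thesis .
qed

text \<open>Off \<open>S\<close>, the entries of \<open>Sigma ** D ** Sigma\<close> are obtained from those on \<open>S\<close> by exactly the matrix
  whose norm the incoherence condition bounds.\<close>

lemma supported_solution_incoherent: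
  fixes Sigma Q :: "real ^ 'p ^ 'p"
  assumes Sigma: "Sigma \<in> sym_pos_def" and ij: "(i, j) \<notin> S"
    and Q: "\<And>i j. \<bar>Q $ i $ j\<bar> \<le> b"
  shows "\<bar>(Sigma ** supported_solution Sigma S Q ** Sigma) $ i $ j\<bar> \<le>
    inf_op_norm (submatrix (- S) S (kronecker Sigma Sigma) ** submatrix_inv S (kronecker Sigma Sigma)) * b"
proof -
  let ?G = "kronecker Sigma Sigma"
  let ?B = "submatrix_inv S ?G"
  let ?A = "submatrix (- S) S ?G ** ?B"
  let ?x = "?B *v vectorize Q"
  have b: "0 \<le> b" using Q[of undefined undefined] by linarith
  have x: "?x = vectorize (supported_solution Sigma S Q)" by (simp add: supported_solution_def)
  have "(Sigma ** supported_solution Sigma S Q ** Sigma) $ i $ j = (?G *v ?x) $ (i, j)"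
    unfolding x kronecker_sym_vectorize[OF Sigma] by (simp add: vectorize_nth)
  also have "\<dots> = (submatrix (- S) S ?G *v ?x) $ (i, j)"
    using ij supported_solution_outside[OF Sigma, of _ _ S Q]
    by (subst submatrix_supported_vec) (auto simp: x vectorize_nth)
  also have "\<dots> = (\<Sum>q\<in>UNIV. ?A $ (i, j) $ q * vectorize Q $ q)"
    by (simp add: matrix_vector_mul_assoc) (simp add: matrix_vector_mult_def)
  finally have "\<bar>(Sigma ** supported_solution Sigma S Q ** Sigma) $ i $ j\<bar> \<le>
      (\<Sum>q\<in>UNIV. \<bar>?A $ (i, j) $ q * vectorize Q $ q\<bar>)" by (simp only: sum_abs)
  also have "\<dots> \<le> (\<Sum>q\<in>UNIV. \<bar>?A $ (i, j) $ q\<bar> * b)"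
    by (intro sum_mono) (simp add: abs_mult mult_left_mono Q vectorize_def)
  also have "\<dots> \<le> inf_op_norm ?A * b"
    unfolding sum_distrib_right[symmetric] using b by (intro mult_right_mono row_sum_le_inf_op_norm)
  finally show ?thesis .
qed

text \<open>The transpose of the solution solves the same problem when \<open>S\<close> and \<open>Q\<close> are symmetric.\<close>

lemma supported_solution_symmetric:
  fixes Sigma Q :: "real ^ 'p ^ 'p"
  assumes Sigma: "Sigma \<in> sym_pos_def" and S: "\<And>i j. (i, j) \<in> S \<Longrightarrow> (j, i) \<in> S"
    and Q: "transpose Q = Q"
  shows "transpose (supported_solution Sigma S Q) = supported_solution Sigma S Q"
proof -
  let ?D = "supported_solution Sigma S Q"
  have Qs: "Q $ i $ j = Q $ j $ i" for i j by (rule symmetric_nth[OF Q])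
  have Ss: "transpose Sigma = Sigma" using Sigma by (simp add: sym_pos_def_def)
  have "Sigma ** transpose ?D ** Sigma = transpose (Sigma ** ?D ** Sigma)"
    by (simp add: matrix_transpose_mul Ss matrix_mul_assoc)
  then have "(Sigma ** transpose ?D ** Sigma) $ i $ j = (Sigma ** ?D ** Sigma) $ j $ i" for i j
    by (simp add: transpose_def)
  moreover have "Sigma ** (transpose ?D - ?D) ** Sigma = Sigma ** transpose ?D ** Sigma - Sigma ** ?D ** Sigma"
    by (simp add: matrix_sub_ldistrib matrix_mult_distrib_right)
  ultimately have "(Sigma ** (transpose ?D - ?D) ** Sigma) $ i $ j = 0" if "(i, j) \<in> S" for i j
    using that supported_solution_inside[OF Sigma, of _ _ S Q] S Qs by simp
  moreover have "(transpose ?D - ?D) $ i $ j = 0" if "(i, j) \<notin> S" for i j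
    using that S supported_solution_outside[OF Sigma, of _ _ S Q] by (auto simp: transpose_def)
  ultimately have "transpose ?D - ?D = 0" using kronecker_supported_inj[OF Sigma] by blast
  then show ?thesis by simp
qed

lemma continuous_on_supported_solution:
  fixes Sigma :: "real ^ 'p ^ 'p"
  shows "continuous_on UNIV (supported_solution Sigma S)"
proof -
  have "continuous_on UNIV (\<lambda>Q. \<chi> i j. \<Sum>q\<in>UNIV.
      submatrix_inv S (kronecker Sigma Sigma) $ (i, j) $ q * Q $ fst q $ snd q)"
    by (intro continuous_intros)
  then show ?thesis
    by (simp add: supported_solution_def[abs_def] matrix_of_vec_def matrix_vector_mult_def vectorize_def)
qed

section \<open>The fixed point\<close>

lemma matrix_inv_sym_pos_def:
  fixes A :: "real ^ 'n ^ 'n"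
  assumes A: "A \<in> sym_pos_def"
  shows "matrix_inv A \<in> sym_pos_def" "matrix_inv A ** A = mat 1" "A ** matrix_inv A = mat 1"
proof -
  have inv: "invertible A"
    using det_sym_pos_def[OF A] by (simp add: invertible_det_nz)
  show AB: "A ** matrix_inv A = mat 1" and BA: "matrix_inv A ** A = mat 1"
    using matrix_inv_both[OF inv] by auto
  let ?B = "matrix_inv A"
  have "transpose ?B ** A ** ?B \<in> sym_pos_def"
    using AB BA by (intro sym_pos_def_congruence A) (auto simp: invertible_def)
  also have At: "transpose A = A" using A by (simp add: sym_pos_def_def)
  have "transpose ?B ** A = mat 1"
    using arg_cong[OF AB, of transpose] by (simp add: matrix_transpose_mul At)
  then have "transpose ?B ** A ** ?B = ?B" by simp
  finally show "?B \<in> sym_pos_def" .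
qed

lemma compact_convex_symmetric_box:
  "compact {Q :: real ^ 'n ^ 'n. transpose Q = Q \<and> (\<forall>i j. \<bar>Q $ i $ j\<bar> \<le> b)}" (is "compact ?D")
  "convex {Q :: real ^ 'n ^ 'n. transpose Q = Q \<and> (\<forall>i j. \<bar>Q $ i $ j\<bar> \<le> b)}"
proof -
  have D: "?D = (\<Inter>i j. {Q. Q $ j $ i = Q $ i $ j}) \<inter> (\<Inter>i j. {Q. \<bar>Q $ i $ j\<bar> \<le> b})"
    by (auto simp: transpose_def vec_eq_iff)
  have cont: "continuous_on UNIV (\<lambda>Q :: real ^ 'n ^ 'n. Q $ i $ j)" for i j
    by (intro continuous_intros)
  have "closed ?D"
    unfolding D by (intro closed_Int closed_INT ballI closed_Collect_eq closed_Collect_le cont continuous_intros)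
  moreover have "bounded ?D"
  proof (rule boundedI)
    fix Q assume Q: "Q \<in> ?D"
    have "norm Q \<le> (\<Sum>i\<in>UNIV. norm (Q $ i))"
      by (simp add: norm_vec_def L2_set_le_sum)
    also have "\<dots> \<le> (\<Sum>i\<in>UNIV. \<Sum>j\<in>UNIV. \<bar>Q $ i $ j\<bar>)"
      by (intro sum_mono norm_le_l1_cart)
    also have "\<dots> \<le> (\<Sum>i\<in>(UNIV :: 'n set). \<Sum>j\<in>(UNIV :: 'n set). b)"
      using Q by (intro sum_mono) auto
    finally show "norm Q \<le> (\<Sum>i\<in>(UNIV :: 'n set). \<Sum>j\<in>(UNIV :: 'n set). b)" .
  qed
  ultimately show "compact ?D" by (simp add: compact_eq_bounded_closed)
  show "convex ?D"
    unfolding D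
  proof (intro convex_Int convex_INT ballI)
    fix i j
    show "convex {Q :: real ^ 'n ^ 'n. Q $ j $ i = Q $ i $ j}"
      by (auto simp: convex_def)
    have "linear (\<lambda>Q :: real ^ 'n ^ 'n. Q $ i $ j)"
      by (auto intro!: linearI)
    then have "convex ((\<lambda>Q :: real ^ 'n ^ 'n. Q $ i $ j) -` {-b..b})"
      by (rule convex_linear_vimage) simp
    moreover have "((\<lambda>Q :: real ^ 'n ^ 'n. Q $ i $ j) -` {-b..b}) = {Q. \<bar>Q $ i $ j\<bar> \<le> b}"
      by (auto simp: abs_le_iff)
    ultimately show "convex {Q :: real ^ 'n ^ 'n. \<bar>Q $ i $ j\<bar> \<le> b}" by simp
  qed
qed

text \<open>The two terms in the minimum are the two estimates \<open>contraction_l1\<close> and \<open>contraction_sparse\<close>, applied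
  to \<open>Delta ** Sigma = K ** P\<close> and to \<open>Delta = K ** P ** K\<close> with \<open>P = Sigma ** Delta ** Sigma\<close>.\<close>

lemma sandwich_entry_contraction:
  fixes K Sigma Delta :: "real ^ 'p ^ 'p"
  assumes Sigma: "Sigma \<in> sym_pos_def" and K: "K = matrix_inv Sigma"
    and supp: "\<And>i j. K $ i $ j = 0 \<Longrightarrow> Delta $ i $ j = 0"
    and P: "\<And>i j. \<bar>(Sigma ** Delta ** Sigma) $ i $ j\<bar> \<le> b"
    and \<eta>: "\<eta> = min (real (max_row_card K) * inf_op_norm Sigma * (inf_op_norm K)\<^sup>2) (l1_norm (vectorize K))"
  shows "entry_contraction (\<eta> * b) (Delta ** Sigma)"
    and "\<bar>Delta $ i $ j\<bar> \<le> (inf_op_norm K)\<^sup>2 * b"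
proof -
  have Ks: "transpose K = K" and KS: "K ** Sigma = mat 1" and SK: "Sigma ** K = mat 1"
    using matrix_inv_sym_pos_def[OF Sigma] by (auto simp: K sym_pos_def_def)
  have Ss: "transpose Sigma = Sigma" using Sigma by (simp add: sym_pos_def_def)
  have "Delta = K ** (Sigma ** Delta ** Sigma) ** K"
  proof -
    have "K ** (Sigma ** Delta ** Sigma) ** K = (K ** Sigma) ** Delta ** (Sigma ** K)"
      by (simp only: matrix_mul_assoc)
    then show ?thesis by (simp add: KS SK)
  qed
  with abs_sandwich_nth_le[OF Ks P]
  show D: "\<bar>Delta $ i $ j\<bar> \<le> (inf_op_norm K)\<^sup>2 * b" for i j by simp
  show "entry_contraction (\<eta> * b) (Delta ** Sigma)"
    unfolding entry_contraction_def
  proof (intro allI impI)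
    fix A :: "real ^ 'p ^ 'p" and a i j
    assume A: "\<forall>i j. \<bar>A $ i $ j\<bar> \<le> a"
    have "Delta ** Sigma = (K ** Sigma) ** (Delta ** Sigma)" by (simp add: KS)
    then have "A ** (Delta ** Sigma) = A ** K ** (Sigma ** Delta ** Sigma)"
      by (simp only: matrix_mul_assoc)
    then have "\<bar>(A ** (Delta ** Sigma)) $ i $ j\<bar> \<le> a * (l1_norm (vectorize K) * b)"
      using contraction_l1[of A a "Sigma ** Delta ** Sigma" b K i j] A P by simp
    moreover have "\<bar>(A ** (Delta ** Sigma)) $ i $ j\<bar> \<le>
        a * (real (max_row_card K) * ((inf_op_norm K)\<^sup>2 * b) * inf_op_norm Sigma)"
      using contraction_sparse[OF Ks Ss supp, of A a "(inf_op_norm K)\<^sup>2 * b" i j] A D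
      by (simp add: matrix_mul_assoc)
    ultimately show "\<bar>(A ** (Delta ** Sigma)) $ i $ j\<bar> \<le> a * (\<eta> * b)"
      unfolding \<eta> by (simp add: min_def mult_ac)
  qed
qed

text \<open>The unknown of the fixed point equation is \<open>Q\<close>, the value of \<open>Sigma ** Delta ** Sigma\<close> prescribed on
  \<open>S\<close>. Because the signs of \<open>K'\<close> turn out to be those of \<open>K\<close>, the subgradient on \<open>S\<close> can be
  fixed in advance as \<open>Z0\<close>, which makes the fixed point map continuous.\<close>

lemma glasso_witness:
  fixes Sigma K Sigma_hat :: "real ^ 'p ^ 'p"
  assumes Sigma: "Sigma \<in> sym_pos_def" and K: "K = matrix_inv Sigma"
    and hat_sym: "transpose Sigma_hat = Sigma_hat"
    and S: "S = support K"
    and \<alpha>: "0 < \<alpha>" "\<alpha> < 1"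
    and incoh: "inf_op_norm (submatrix (- S) S (kronecker Sigma Sigma) **
        submatrix_inv S (kronecker Sigma Sigma)) \<le> 1 - \<alpha>"
    and \<eta>: "\<eta> = min (real (max_row_card K) * inf_op_norm Sigma * (inf_op_norm K)\<^sup>2)
        (l1_norm (vectorize K))"
    and b: "0 < b" "\<eta> * b < 1" and lam: "lam = (1 - \<alpha> / 2) * b"
    and noise: "\<And>i j. \<bar>(Sigma_hat - Sigma) $ i $ j\<bar> \<le> \<delta>"
    and room: "\<delta> + \<eta> * b * b / (1 - \<eta> * b) < \<alpha> / 2 * b"
    and signal: "\<And>i j. K $ i $ j \<noteq> 0 \<Longrightarrow> (inf_op_norm K)\<^sup>2 * b \<le> \<bar>K $ i $ j\<bar>"
  obtains K' where "K' \<in> sym_pos_def"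
    "\<And>B. B \<in> sym_pos_def \<Longrightarrow> B \<noteq> K' \<Longrightarrow>
      glasso_objective Sigma_hat lam K' < glasso_objective Sigma_hat lam B"
    "\<And>i j. sgn (K' $ i $ j) = sgn (K $ i $ j)"
    "\<And>i j. \<bar>(K' - K) $ i $ j\<bar> \<le> (inf_op_norm K)\<^sup>2 * b"
proof -
  define c \<rho> where "c = \<eta> * b" and "\<rho> = c * b / (1 - c)"
  have c1: "c < 1" using b by (simp add: c_def)
  have room': "\<delta> + \<rho> < \<alpha> / 2 * b" using room by (simp add: \<rho>_def c_def)
  have Kp: "K \<in> sym_pos_def" and KS: "K ** Sigma = mat 1" and SK: "Sigma ** K = mat 1"
    using matrix_inv_sym_pos_def[OF Sigma] by (auto simp: K)
  have Ks: "transpose K = K" and Ss: "transpose Sigma = Sigma"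
    using Kp Sigma by (auto simp: sym_pos_def_def)
  have lam0: "lam > 0" using \<alpha> b by (simp add: lam)
  have Ssym: "(j, i) \<in> S" if "(i, j) \<in> S" for i j
    using that symmetric_nth[OF Ks] by (auto simp: S support_def)
  define Z0 :: "real ^ 'p ^ 'p" where "Z0 = (\<chi> i j. if i = j then 0 else sgn (K $ i $ j))"
  have Z0s: "transpose Z0 = Z0"
    using symmetric_nth[OF Ks] by (auto simp: Z0_def transpose_def vec_eq_iff)
  define D where "D = supported_solution Sigma S"
  define P where "P Q = Sigma ** D Q ** Sigma" for Q
  define W where "W Q = matrix_inv (K + D Q)" for Q
  define R where "R Q = W Q - Sigma + P Q" for Q
  \<comment> \<open>On \<open>S\<close>, where \<open>P Q\<close> and \<open>Q\<close> agree, \<open>F Q = Q\<close> says \<open>W Q = Sigma_hat + lam *\<^sub>R Z0\<close>.\<close>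
  define F where "F Q = R Q - (Sigma_hat - Sigma) - lam *\<^sub>R Z0" for Q
  define box :: "(real ^ 'p ^ 'p) set" where
    "box = {Q. transpose Q = Q \<and> (\<forall>i j. \<bar>Q $ i $ j\<bar> \<le> b)}"
  have supp: "D Q $ i $ j = 0" if "K $ i $ j = 0" for Q i j
    using that supported_solution_outside[OF Sigma, of i j S Q] by (simp add: D_def S support_def)
  have PS: "P Q $ i $ j = Q $ i $ j" if "(i, j) \<in> S" for Q i j
    using that supported_solution_inside[OF Sigma] by (simp add: P_def D_def)
  have PSc: "\<bar>P Q $ i $ j\<bar> \<le> (1 - \<alpha>) * b" if "Q \<in> box" "(i, j) \<notin> S" for Q i j
  proof -
    have "\<bar>P Q $ i $ j\<bar> \<le> inf_op_norm (submatrix (- S) S (kronecker Sigma Sigma) **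
        submatrix_inv S (kronecker Sigma Sigma)) * b"
      using that unfolding P_def D_def by (intro supported_solution_incoherent[OF Sigma]) (auto simp: box_def)
    also have "\<dots> \<le> (1 - \<alpha>) * b" using incoh b by (intro mult_right_mono) auto
    finally show ?thesis .
  qed
  have Pb: "\<bar>P Q $ i $ j\<bar> \<le> b" if Q: "Q \<in> box" for Q i j
  proof (cases "(i, j) \<in> S")
    case True
    then show ?thesis using PS Q by (simp add: box_def)
  next
    case False
    have "(1 - \<alpha>) * b \<le> b" using \<alpha> b by (simp add: algebra_simps)
    with PSc[OF Q False] show ?thesis by linarith
  qed
  have contr: "entry_contraction c (D Q ** Sigma)" if Q: "Q \<in> box" for Q
    unfolding c_def
    by (rule sandwich_entry_contraction(1)[OF Sigma K supp _ \<eta>]) (assumption, rule Pb[OF Q, unfolded P_def])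
  have Ds: "transpose (D Q) = D Q" if "Q \<in> box" for Q
    unfolding D_def using that Ssym by (intro supported_solution_symmetric[OF Sigma]) (auto simp: box_def)
  have KDs: "transpose (K + s *\<^sub>R D Q) = K + s *\<^sub>R D Q" if "Q \<in> box" for Q s
    using Ks Ds[OF that] by (simp add: transpose_def vec_eq_iff)
  have inv: "invertible (K + s *\<^sub>R D Q)" if Q: "Q \<in> box" and s: "0 \<le> s" "s \<le> 1" for Q s
  proof (rule invertible_of_entry_contraction[OF KDs[OF Q] KS _ c1])
    show "entry_contraction c (s *\<^sub>R D Q ** Sigma)"
      using entry_contraction_scale[OF contr[OF Q] s] by (simp add: matrix_scaleR_mult)
  qed
  have inv1: "invertible (K + D Q)" if "Q \<in> box" for Q
    using inv[OF that, of 1] by simp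
  have W: "W Q ** (K + D Q) = mat 1" "(K + D Q) ** W Q = mat 1" if "Q \<in> box" for Q
    unfolding W_def using matrix_inv_both[OF inv1[OF that]] by auto
  have E: "W Q - Sigma = - P Q - (W Q - Sigma) ** (D Q ** Sigma)" if "Q \<in> box" for Q
    unfolding P_def by (rule matrix_inv_perturbation[OF KS W(1)[OF that]])
  have Eb: "\<bar>(W Q - Sigma) $ i $ j\<bar> \<le> b / (1 - c)" if Q: "Q \<in> box" for Q i j
    by (rule entry_contraction_bound[OF contr[OF Q] c1 E[OF Q] Pb[OF Q]])
  have Rb: "\<bar>R Q $ i $ j\<bar> \<le> \<rho>" if Q: "Q \<in> box" for Q i j
  proof -
    have "R Q = - ((W Q - Sigma) ** (D Q ** Sigma))"
      unfolding R_def by (subst E[OF Q]) simp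
    then have "\<bar>R Q $ i $ j\<bar> = \<bar>((W Q - Sigma) ** (D Q ** Sigma)) $ i $ j\<bar>" by simp
    also have "\<dots> \<le> b / (1 - c) * c" by (rule entry_contractionD[OF contr[OF Q] Eb[OF Q]])
    finally show ?thesis by (simp add: \<rho>_def mult.commute)
  qed
  have Z0b: "\<bar>Z0 $ i $ j\<bar> \<le> 1" for i j
    by (simp add: Z0_def abs_sgn_eq)
  have Fb: "\<bar>F Q $ i $ j\<bar> < b" if Q: "Q \<in> box" for Q i j
  proof -
    have "\<bar>lam * Z0 $ i $ j\<bar> \<le> lam"
      using mult_left_mono[OF Z0b[of i j], of lam] lam0 by (simp add: abs_mult)
    then have "\<bar>F Q $ i $ j\<bar> \<le> \<rho> + \<delta> + lam"
      using Rb[OF Q, of i j] noise[of i j] by (simp add: F_def)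
    also have "\<dots> < b" using room' by (simp add: lam algebra_simps)
    finally show ?thesis .
  qed
  have Ws: "transpose (W Q) = W Q" if Q: "Q \<in> box" for Q
  proof -
    have "transpose (W Q) ** (K + D Q) = mat 1"
      using arg_cong[OF W(2)[OF Q], of transpose] KDs[OF Q, of 1]
      by (simp add: matrix_transpose_mul)
    then have "transpose (W Q) ** ((K + D Q) ** W Q) = W Q"
      by (simp add: matrix_mul_assoc)
    then show ?thesis by (simp add: W(2)[OF Q])
  qed
  have Fs: "transpose (F Q) = F Q" if Q: "Q \<in> box" for Q
  proof -
    have "transpose (P Q) = P Q"
      using Ds[OF Q] by (simp add: P_def matrix_transpose_mul Ss matrix_mul_assoc)
    then show ?thesis
      using Ws[OF Q] hat_sym Z0s Ss
      by (simp add: F_def R_def transpose_def vec_eq_iff)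
  qed
  have "continuous_on box F"
  proof -
    have D: "continuous_on box D"
      unfolding D_def by (rule continuous_on_subset[OF continuous_on_supported_solution]) simp
    have "continuous_on box W"
      unfolding W_def by (intro continuous_on_matrix_inv continuous_intros D inv1)
    moreover have "continuous_on box P"
      unfolding P_def by (intro continuous_on_matrix_mult continuous_intros D)
    ultimately show ?thesis unfolding F_def R_def by (intro continuous_intros)
  qed
  moreover have "F \<in> box \<rightarrow> box"
    using Fb Fs by (auto simp: box_def less_imp_le)
  moreover have "compact box" "convex box"
    unfolding box_def by (rule compact_convex_symmetric_box)+
  moreover have "0 \<in> box" using b by (simp add: box_def transpose_def vec_eq_iff)
  then have "box \<noteq> {}" by blast
  ultimately obtain Q where Q: "Q \<in> box" and fixed: "F Q = Q"
    using brouwer[of box F] by metis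
  define K' where "K' = K + D Q"
  \<comment> \<open>The subgradient is read off from the stationarity condition; what remains is that it is one.\<close>
  define Z where "Z = (W Q - Sigma_hat) /\<^sub>R lam"
  have K': "K' \<in> sym_pos_def"
    unfolding K'_def using inv[OF Q] Ds[OF Q]
    by (intro sym_pos_def_of_invertible_segment[OF Kp]) auto
  have ZS: "Z $ i $ j = Z0 $ i $ j" if "(i, j) \<in> S" for i j
  proof -
    have "R Q $ i $ j - (Sigma_hat - Sigma) $ i $ j - lam * Z0 $ i $ j = P Q $ i $ j"
      using arg_cong[OF fixed, of "\<lambda>M. M $ i $ j"] PS[OF that, of Q] by (simp add: F_def)
    then have "(W Q - Sigma_hat) $ i $ j = lam * Z0 $ i $ j" by (simp add: R_def)
    then show ?thesis using lam0 by (simp add: Z_def)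
  qed
  have ZSc: "\<bar>Z $ i $ j\<bar> \<le> 1" if "(i, j) \<notin> S" for i j
  proof -
    have "(W Q - Sigma_hat) $ i $ j = R Q $ i $ j - P Q $ i $ j - (Sigma_hat - Sigma) $ i $ j"
      by (simp add: R_def)
    then have "\<bar>(W Q - Sigma_hat) $ i $ j\<bar> \<le> \<rho> + (1 - \<alpha>) * b + \<delta>"
      using Rb[OF Q, of i j] PSc[OF Q that] noise[of i j] by linarith
    also have "\<dots> \<le> lam" using room' by (simp add: lam algebra_simps)
    finally have "\<bar>(W Q - Sigma_hat) $ i $ j\<bar> \<le> lam" .
    then show ?thesis using lam0 by (simp add: Z_def abs_mult field_simps)
  qed
  have Pstrict: "\<bar>(Sigma ** D Q ** Sigma) $ i $ j\<bar> < b" for i j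
  proof (cases "(i, j) \<in> S")
    case True
    then show ?thesis using PS[OF True, of Q] Fb[OF Q, of i j] by (simp add: fixed P_def)
  next
    case False
    have "(1 - \<alpha>) * b < b" using \<alpha> b by (simp add: algebra_simps)
    with PSc[OF Q False] show ?thesis by (simp add: P_def)
  qed
  \<comment> \<open>Passing through the largest entry keeps the inequality strict: a change of size exactly \<open>\<bar>K $ i $ j\<bar>\<close> could set an entry to 0.\<close>
  obtain k l where max: "\<And>i j. \<bar>(Sigma ** D Q ** Sigma) $ i $ j\<bar> \<le> \<bar>(Sigma ** D Q ** Sigma) $ k $ l\<bar>"
    by (rule obtain_max_entry[of "Sigma ** D Q ** Sigma"]) (rule that)
  have Dmax: "\<bar>D Q $ i $ j\<bar> \<le> (inf_op_norm K)\<^sup>2 * \<bar>(Sigma ** D Q ** Sigma) $ k $ l\<bar>" for i j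
    by (rule sandwich_entry_contraction(2)[OF Sigma K supp max \<eta>])
  have D_le: "\<bar>D Q $ i $ j\<bar> \<le> (inf_op_norm K)\<^sup>2 * b" for i j
    using Dmax[of i j] mult_left_mono[OF less_imp_le[OF Pstrict[of k l]], of "(inf_op_norm K)\<^sup>2"] by simp
  have sgn_eq: "sgn (K' $ i $ j) = sgn (K $ i $ j)" for i j
  proof (cases "K $ i $ j = 0")
    case True
    then show ?thesis using supp by (simp add: K'_def)
  next
    case False
    have "inf_op_norm K > 0" using inf_op_norm_pos[OF False] .
    then have "(inf_op_norm K)\<^sup>2 * \<bar>(Sigma ** D Q ** Sigma) $ k $ l\<bar> < (inf_op_norm K)\<^sup>2 * b"
      using Pstrict[of k l] by (intro mult_strict_left_mono) auto
    then have "\<bar>D Q $ i $ j\<bar> < \<bar>K $ i $ j\<bar>"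
      using Dmax[of i j] signal[OF False] by linarith
    then show ?thesis by (auto simp: K'_def sgn_if)
  qed
  have SK': "(i, j) \<in> S \<longleftrightarrow> K $ i $ j \<noteq> 0" for i j by (simp add: S support_def)
  have diag: "(i, i) \<in> S" for i
    using sym_pos_def_diag_pos[OF Kp, of i] by (simp add: SK')
  have "glasso_objective Sigma_hat lam K' < glasso_objective Sigma_hat lam B"
    if B: "B \<in> sym_pos_def" "B \<noteq> K'" for B
  proof (rule glasso_kkt_sufficient[OF K' _ _ _ _ _ _ B])
    show "W Q ** K' = mat 1" unfolding K'_def by (rule W(1)[OF Q])
    show "W Q = Sigma_hat + lam *\<^sub>R Z" using lam0 by (simp add: Z_def)
    show "lam \<ge> 0" using lam0 by simp
    show "Z $ i $ i = 0" for i using ZS[OF diag] by (simp add: Z0_def)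
    show "\<bar>Z $ i $ j\<bar> \<le> 1" for i j
      using ZS ZSc Z0b by (cases "(i, j) \<in> S") auto
    show "Z $ i $ j * K' $ i $ j = \<bar>K' $ i $ j\<bar>" if "i \<noteq> j" for i j
    proof (cases "(i, j) \<in> S")
      case True
      then have "Z $ i $ j = sgn (K' $ i $ j)" using ZS that sgn_eq by (simp add: Z0_def)
      then show ?thesis by (simp add: sgn_mult_self_eq abs_sgn mult.commute)
    next
      case False
      then have "sgn (K' $ i $ j) = 0" using sgn_eq[of i j] SK' by simp
      then show ?thesis by (simp add: sgn_0_0)
    qed
  qed
  then show thesis
    using that[OF K'] sgn_eq D_le by (simp add: K'_def)
qed

section \<open>Sign consistency\<close>

text \<open>Here \<open>x\<close> stands for \<open>\<eta> * \<theta> / \<kappa>\<^sup>2\<close> and \<open>e\<close> for \<open>\<eta> * \<delta>\<close>. In the first case, after division by \<open>\<alpha>\<^sup>2 / 16\<close>, the claim is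
  \<open>1 / (1 - \<alpha> / 4) < 1 + \<alpha> / 3\<close>, which is equivalent to \<open>\<alpha> < 1\<close>. In the second it is
  \<open>c / (1 - c) < \<alpha> / 3\<close>, which follows from \<open>c < \<alpha> / 4\<close> in the same way.\<close>

lemma glasso_noise_room:
  fixes \<alpha> x c e :: real
  assumes \<alpha>: "0 < \<alpha>" "\<alpha> < 1" and x: "0 < x"
    and c: "c = min (\<alpha> / 4) x"
    and e: "e = (if \<alpha> \<le> 4 * x then \<alpha>\<^sup>2 / 16 * (1 - \<alpha> / 3) else \<alpha> / 6 * x)"
  shows "e + c * c / (1 - c) < \<alpha> / 2 * c"
proof (cases "\<alpha> \<le> 4 * x")
  case True
  then have c': "c = \<alpha> / 4" and e': "e = \<alpha>\<^sup>2 / 16 * (1 - \<alpha> / 3)" by (auto simp: c e)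
  have "\<alpha> * \<alpha> < \<alpha>" using \<alpha> by simp
  then have "1 / (1 - \<alpha> / 4) < 1 + \<alpha> / 3" using \<alpha> by (simp add: field_simps)
  then have "\<alpha>\<^sup>2 / 16 * (1 / (1 - \<alpha> / 4)) < \<alpha>\<^sup>2 / 16 * (1 + \<alpha> / 3)"
    using \<alpha> by (intro mult_strict_left_mono) auto
  moreover have "c * c / (1 - c) = \<alpha>\<^sup>2 / 16 * (1 / (1 - \<alpha> / 4))"
    by (simp add: c' power2_eq_square)
  moreover have "\<alpha> / 2 * c = \<alpha>\<^sup>2 / 16 * (1 - \<alpha> / 3) + \<alpha>\<^sup>2 / 16 * (1 + \<alpha> / 3)"
    by (simp add: c' power2_eq_square field_simps)
  ultimately show ?thesis unfolding e' by linarith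
next
  case False
  then have c': "c = x" and e': "e = \<alpha> / 6 * c" and lt: "c < \<alpha> / 4" by (auto simp: c e)
  have c0: "0 < c" using x by (simp add: c')
  have "\<alpha> / 3 * (1 - \<alpha> / 4) \<ge> \<alpha> / 4" using \<alpha> by (simp add: field_simps)
  moreover have "\<alpha> / 3 * (1 - \<alpha> / 4) < \<alpha> / 3 * (1 - c)"
    using \<alpha> lt by (intro mult_strict_left_mono) auto
  ultimately have "c < \<alpha> / 3 * (1 - c)" using lt by linarith
  then have "c / (1 - c) < \<alpha> / 3" using \<alpha> lt by (simp add: pos_divide_less_eq)
  then have "c * (c / (1 - c)) < c * (\<alpha> / 3)" using c0 by (rule mult_strict_left_mono)
  then show ?thesis by (simp add: e' algebra_simps)
qed

theorem theorem3p5: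
  fixes M :: "'w measure" and X :: "'w \<Rightarrow> real ^ 'p"
    and N :: "'v measure" and Xs :: "nat \<Rightarrow> 'v \<Rightarrow> real ^ 'p" and n :: nat and \<omega> :: 'v
    and Sigma K Sigma_hat :: "real ^ 'p ^ 'p"
    and Gamma :: "real ^ ('p \<times> 'p) ^ ('p \<times> 'p)" and S :: "('p \<times> 'p) set"
    and \<alpha> \<eta> \<theta> \<delta> lam :: real and d :: nat
  assumes "prob_space M"
    and "X \<in> borel_measurable M"
    and "\<And>i. integrable M (\<lambda>w. (X w $ i)\<^sup>2)"
    and "\<And>i. (LINT w|M. X w $ i) = 0"
    and "Sigma = covariance_matrix M X"
    and "Sigma \<in> sym_pos_def"
    and "prob_space N"
    and "n \<ge> 1"
    and "prob_space.indep_vars N (\<lambda>_. borel) Xs {1..n}"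
    and "\<And>i. i \<in> {1..n} \<Longrightarrow> distr N borel (Xs i) = distr M borel X"
    and "\<omega> \<in> space N"
    and "Sigma_hat = sample_covariance n (\<lambda>i. Xs i \<omega>)"
    and "K = matrix_inv Sigma"
    and "Gamma = kronecker Sigma Sigma"
    and "S = support K"
    and "d = max_row_card K"
    and "\<theta> = theta_min K"
    and "0 < \<alpha>" and "\<alpha> < 1"
    and "inf_op_norm (submatrix (- S) S Gamma ** submatrix_inv S Gamma) \<le> 1 - \<alpha>"
    and "\<eta> = min (real d * inf_op_norm Sigma * (inf_op_norm K)\<^sup>2) (l1_norm (vectorize K))"
    and "lam = min (\<alpha> / 4) (\<eta> * \<theta> / (inf_op_norm K)\<^sup>2) * (1 - \<alpha> / 2) / \<eta>"
    and "\<delta> = (if \<alpha> \<le> 4 * \<eta> * \<theta> / (inf_op_norm K)\<^sup>2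
              then \<alpha>\<^sup>2 / (16 * \<eta>) * (1 - \<alpha> / 3)
              else \<alpha> / 6 * \<theta> / (inf_op_norm K)\<^sup>2)"
    and "infnorm (vectorize (Sigma_hat - Sigma)) \<le> \<delta>"
  shows "(\<exists>!K'. is_arg_min (glasso_objective Sigma_hat lam) (\<lambda>A. A \<in> sym_pos_def) K') \<and>
    (\<forall>K_hat. is_arg_min (glasso_objective Sigma_hat lam) (\<lambda>A. A \<in> sym_pos_def) K_hat \<longrightarrow>
      (\<forall>i j. sgn (K_hat $ i $ j) = sgn (K $ i $ j)) \<and>
      infnorm (vectorize (K_hat - K)) \<le> \<alpha> * (inf_op_norm K)\<^sup>2 / (4 * \<eta>)) \<and>
    \<alpha> * (inf_op_norm K)\<^sup>2 / (4 * \<eta>) =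
      \<alpha> / 4 * max (1 / (real d * inf_op_norm Sigma))
                  ((inf_op_norm K)\<^sup>2 / l1_norm (vectorize K))"
proof -
  note Sigma = \<open>Sigma \<in> sym_pos_def\<close>
  define \<kappa> where "\<kappa> = inf_op_norm K"
  define c where "c = min (\<alpha> / 4) (\<eta> * \<theta> / \<kappa>\<^sup>2)"
  define b where "b = c / \<eta>"
  have Kp: "K \<in> sym_pos_def"
    using matrix_inv_sym_pos_def[OF Sigma] assms(13) by simp
  obtain i0 :: 'p where True by simp
  have K0: "K $ i0 $ i0 \<noteq> 0" and S0: "Sigma $ i0 $ i0 \<noteq> 0"
    using sym_pos_def_diag_pos[OF Kp, of i0] sym_pos_def_diag_pos[OF Sigma, of i0] by auto
  have \<kappa>: "\<kappa> > 0" and s: "inf_op_norm Sigma > 0"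
    using inf_op_norm_pos K0 S0 by (auto simp: \<kappa>_def)
  have d: "real d > 0"
  proof -
    have "0 < card {j. K $ i0 $ j \<noteq> 0}" using K0 by (auto simp: card_gt_0_iff)
    then show ?thesis using row_card_le_max_row_card[of K i0] assms(16) by simp
  qed
  have L: "l1_norm (vectorize K) > 0"
  proof -
    have "\<bar>K $ i0 $ i0\<bar> \<le> l1_norm (vectorize K)"
      unfolding l1_norm_def using member_le_sum[of "(i0, i0)" UNIV "\<lambda>p. \<bar>vectorize K $ p\<bar>"]
      by (simp add: vectorize_nth)
    then show ?thesis using K0 by simp
  qed
  have \<eta>: "\<eta> > 0" using \<kappa> s d L by (simp add: assms(21) \<kappa>_def)
  have \<theta>_le: "\<theta> \<le> \<bar>K $ i $ j\<bar>" if "K $ i $ j \<noteq> 0" for i j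
    unfolding assms(17) theta_min_def using that by (intro Min_le) (force simp: support_def)+
  have \<theta>: "\<theta> > 0"
  proof -
    have "support K \<noteq> {}" using K0 by (auto simp: support_def)
    then show ?thesis unfolding assms(17) theta_min_def
      by (subst Min_gr_iff) (auto simp: support_def)
  qed
  have c: "0 < c" "c < 1" using \<eta> \<theta> \<kappa> assms(18,19) by (auto simp: c_def)
  have \<eta>b: "\<eta> * b = c" using \<eta> by (simp add: b_def)
  have b: "0 < b" using c \<eta> by (simp add: b_def)
  have room: "\<delta> + \<eta> * b * b / (1 - \<eta> * b) < \<alpha> / 2 * b"
  proof -
    have "\<eta> * \<delta> = (if \<alpha> \<le> 4 * (\<eta> * \<theta> / \<kappa>\<^sup>2) then \<alpha>\<^sup>2 / 16 * (1 - \<alpha> / 3) else \<alpha> / 6 * (\<eta> * \<theta> / \<kappa>\<^sup>2))"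
      using \<eta> by (simp add: assms(23) \<kappa>_def field_simps)
    then have "\<eta> * \<delta> + c * c / (1 - c) < \<alpha> / 2 * c"
      using glasso_noise_room[of \<alpha> "\<eta> * \<theta> / \<kappa>\<^sup>2" c "\<eta> * \<delta>"] assms(18,19) \<eta> \<theta> \<kappa> by (simp add: c_def)
    then have "(\<eta> * \<delta> + c * c / (1 - c)) / \<eta> < (\<alpha> / 2 * c) / \<eta>"
      using \<eta> by (rule divide_strict_right_mono)
    moreover have "(\<eta> * \<delta> + c * c / (1 - c)) / \<eta> = \<delta> + c * b / (1 - c)"
      using \<eta> by (simp add: b_def add_divide_distrib mult.commute)
    moreover have "(\<alpha> / 2 * c) / \<eta> = \<alpha> / 2 * b" by (simp add: b_def)
    ultimately show ?thesis by (simp only: \<eta>b)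
  qed
  have \<kappa>b: "\<kappa>\<^sup>2 * b = min (\<alpha> * \<kappa>\<^sup>2 / (4 * \<eta>)) \<theta>"
  proof -
    have "\<kappa>\<^sup>2 / \<eta> > 0" using \<kappa> \<eta> by simp
    have "\<kappa>\<^sup>2 * b = \<kappa>\<^sup>2 / \<eta> * c" by (simp add: b_def)
    also have "\<dots> = min (\<kappa>\<^sup>2 / \<eta> * (\<alpha> / 4)) (\<kappa>\<^sup>2 / \<eta> * (\<eta> * \<theta> / \<kappa>\<^sup>2))"
      unfolding c_def using \<open>\<kappa>\<^sup>2 / \<eta> > 0\<close> by (simp only: min_mult_distrib_left less_imp_le if_True)
    also have "\<dots> = min (\<alpha> * \<kappa>\<^sup>2 / (4 * \<eta>)) \<theta>"
      using \<kappa> \<eta> by (simp add: field_simps)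
    finally show ?thesis .
  qed
  have hat: "transpose Sigma_hat = Sigma_hat"
    by (simp add: assms(12) sample_covariance_def transpose_def vec_eq_iff mult.commute)
  obtain K' where K': "K' \<in> sym_pos_def"
    "\<And>B. B \<in> sym_pos_def \<Longrightarrow> B \<noteq> K' \<Longrightarrow>
      glasso_objective Sigma_hat lam K' < glasso_objective Sigma_hat lam B"
    "\<And>i j. sgn (K' $ i $ j) = sgn (K $ i $ j)"
    "\<And>i j. \<bar>(K' - K) $ i $ j\<bar> \<le> \<kappa>\<^sup>2 * b"
  proof (rule glasso_witness[OF Sigma assms(13) hat assms(15) assms(18,19) _ _ b _ _ _ room])
    show "inf_op_norm (submatrix (- S) S (kronecker Sigma Sigma) **
        submatrix_inv S (kronecker Sigma Sigma)) \<le> 1 - \<alpha>"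
      using assms(20) by (simp add: assms(14))
    show "\<eta> = min (real (max_row_card K) * inf_op_norm Sigma * (inf_op_norm K)\<^sup>2)
        (l1_norm (vectorize K))" using assms(21) by (simp add: assms(16))
    show "\<eta> * b < 1" using c \<eta>b by simp
    show "lam = (1 - \<alpha> / 2) * b" by (simp add: assms(22) b_def c_def \<kappa>_def)
    show "\<bar>(Sigma_hat - Sigma) $ i $ j\<bar> \<le> \<delta>" for i j
      using assms(24) by (simp only: infnorm_vectorize_le_iff)
    show "(inf_op_norm K)\<^sup>2 * b \<le> \<bar>K $ i $ j\<bar>" if "K $ i $ j \<noteq> 0" for i j
      using \<kappa>b \<theta>_le[OF that] by (simp add: \<kappa>_def)
  qed (use that \<kappa>_def in blast)
  have arg: "is_arg_min (glasso_objective Sigma_hat lam) (\<lambda>A. A \<in> sym_pos_def) B \<longleftrightarrow> B = K'" for B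
    unfolding is_arg_min_def using K'(1,2) by (metis less_asym)
  have err: "infnorm (vectorize (K' - K)) \<le> \<alpha> * (inf_op_norm K)\<^sup>2 / (4 * \<eta>)"
    unfolding infnorm_vectorize_le_iff
  proof (intro allI)
    fix i j
    have "\<kappa>\<^sup>2 * b \<le> \<alpha> * (inf_op_norm K)\<^sup>2 / (4 * \<eta>)" by (simp add: \<kappa>b) (simp add: \<kappa>_def)
    then show "\<bar>(K' - K) $ i $ j\<bar> \<le> \<alpha> * (inf_op_norm K)\<^sup>2 / (4 * \<eta>)"
      using K'(4)[of i j] by linarith
  qed
  have "\<alpha> * \<kappa>\<^sup>2 / (4 * \<eta>) = \<alpha> / 4 * (\<kappa>\<^sup>2 / \<eta>)" by simp
  also have "\<kappa>\<^sup>2 / \<eta> = max (1 / (real d * inf_op_norm Sigma)) (\<kappa>\<^sup>2 / l1_norm (vectorize K))"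
  proof -
    let ?x = "real d * inf_op_norm Sigma"
    have x: "?x > 0" using d s by simp
    have 1: "\<kappa>\<^sup>2 / (?x * \<kappa>\<^sup>2) = 1 / ?x" using \<kappa> by simp
    have 2: "\<kappa>\<^sup>2 / u \<le> \<kappa>\<^sup>2 / v" if "0 < v" "v \<le> u" for u v :: real
      using that by (intro divide_left_mono) auto
    have p: "0 < ?x * \<kappa>\<^sup>2" using x \<kappa> by simp
    show ?thesis
    proof (cases "?x * \<kappa>\<^sup>2 \<le> l1_norm (vectorize K)")
      case True
      have "\<kappa>\<^sup>2 / l1_norm (vectorize K) \<le> 1 / ?x" using 2[OF p True] 1 by simp
      then show ?thesis
        unfolding assms(21) \<kappa>_def[symmetric] by (simp only: min_absorb1[OF True] max_absorb1 1)
    next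
      case False
      then have le: "l1_norm (vectorize K) \<le> ?x * \<kappa>\<^sup>2" by simp
      have "1 / ?x \<le> \<kappa>\<^sup>2 / l1_norm (vectorize K)" using 2[OF L le] 1 by simp
      then show ?thesis
        unfolding assms(21) \<kappa>_def[symmetric] by (simp only: min_absorb2[OF le] max_absorb2)
    qed
  qed
  finally show ?thesis
    using err K'(3) unfolding arg \<kappa>_def by auto
qed

end
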